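(* Let $\alpha$ be a composition of $n$ and $D=D(\alpha)\subset[n-1]$ the corresponding descent set. Then for each $i\ge0$, $$L_\alpha^{(i)}=\sum_{E\subset[n+i-1]}|T(D,E)|\,L_{\mathcal C(E)}\qquad\text{and}\qquad M_\alpha^{(i)}=\sum_{E\subset[n+i-1]}|T(D,E)|\,M_{\mathcal C(E)}.$$ Moreover, for each $i,j\ge0$ and $f\in\mathrm{QSym}$, one has $(f^{(i)})^{(j)}=\binom{i+j}{i}f^{(i+j)}$.
   Context: For a composition $\alpha=(\alpha_1,\dots,\alpha_k)$ of $n$, $D(\alpha)=\{\alpha_1,\alpha_1+\alpha_2,\dots,\alpha_1+\cdots+\alpha_{k-1}\}\subset[n-1]$; this is a bijection between compositions of $n$ and subsets of $[n-1]$, with inverse $\mathcal C$. $\mathrm{QSym}$ is the ring of quasisymmetric functions over $\mathbb Z$ in $x_1,x_2,\dots$. It has the monomial basis $M_\alpha=\sum_{i_1<\cdots<i_k}x_{i_1}^{\alpha_1}\cdots x_{i_k}^{\alpha_k}$ and the fundamental basis $L_\alpha=\sum_{D(\beta)\supset D(\alpha),\,|\beta|=|\alpha|}M_\beta$. Multi-fundamental quasisymmetric functions: for a composition $\alpha$ of $n$, choose a permutation $w\in S_n$ with descent set $\{i:w_i>w_{i+1}\}=D(\alpha)$. $\tilde L_\alpha$ is the sum, over all sequences $(\sigma_1,\dots,\sigma_n)$ of nonempty finite sets of positive integers with $\max\sigma_i\le\min\sigma_{i+1}$ if $w_i<w_{i+1}$ and $\max\sigma_i<\min\sigma_{i+1}$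 if $w_i>w_{i+1}$, of $\prod_{i=1}^n\prod_{r\in\sigma_i}x_r$. Let $H_d(f)$ be the homogeneous degree $d$ component of a power series $f$. For $i\ge0$, the linear map $f\mapsto f^{(i)}$, $\mathrm{QSym}\to\mathrm{QSym}$, is defined by $L_\alpha^{(i)}=H_{i+|\alpha|}(\tilde L_\alpha)$, extended linearly. For $D\subset[n-1]$ and $E\subset[n+i-1]$, an $i$-extension of $D$ to $E$ is an injective order-preserving map $t:[n-1]\to[n+i-1]$ with $t(D)\subset E$ and $E\setminus t(D)=[n+i-1]\setminus t([n-1])$. $T(D,E)$ is the set of $i$-extensions of $D$ to $E$. *)

theory Defs
  imports "HOL-Library.Multiset" "HOL-Library.FuncSet" "HOL-Combinatorics.Permutations"
begin

section \<open>Compositions and descent sets\<close>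

definition compositions :: "nat \<Rightarrow> nat list set" where
  "compositions n = {\<alpha>. 0 \<notin> set \<alpha> \<and> sum_list \<alpha> = n}"

definition descent_set :: "nat list \<Rightarrow> nat set" where
  "descent_set \<alpha> = {sum_list (take j \<alpha>) | j. 1 \<le> j \<and> j < length \<alpha>}"

definition composition_of_set :: "nat \<Rightarrow> nat set \<Rightarrow> nat list" where
  "composition_of_set n = the_inv_into (compositions n) descent_set"

section \<open>Power series in \<open>x\<^sub>1, x\<^sub>2, \<dots>\<close>\<close>

text \<open>
  A monomial is the multiset of the indices of its variables, so that the product of monomials is
  \<open>+\<close> and the degree is \<^const>\<open>size\<close>. A power series over the integers is its coefficient function.
  There is no variable \<open>x\<^sub>0\<close>: membership in \<open>QSym\<close> below forces the coefficient of every multiset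
  containing \<open>0\<close> to vanish.
\<close>

type_synonym series = "nat multiset \<Rightarrow> int"

text \<open>
  The formal sum of the monomials \<open>\<mu> s\<close>, \<open>s \<in> S\<close>. In all uses only finitely many \<open>s\<close>
  contribute to a given monomial, so the cardinality below is never that of an infinite set.
\<close>

definition monomial_sum :: "'a set \<Rightarrow> ('a \<Rightarrow> nat multiset) \<Rightarrow> series" where
  "monomial_sum S \<mu> = (\<lambda>m. int (card {s \<in> S. \<mu> s = m}))"

definition homogeneous_part :: "nat \<Rightarrow> series \<Rightarrow> series" where
  "homogeneous_part d f = (\<lambda>m. if size m = d then f m else 0)"

section \<open>Quasisymmetric functions\<close>

definition index_sequences :: "nat \<Rightarrow> nat list set" where
  "index_sequences k = {is. length is = k \<and> sorted_wrt (<) is \<and> 0 \<notin> set is}"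

definition power_product :: "nat list \<Rightarrow> nat list \<Rightarrow> nat multiset" where
  "power_product \<alpha> is = (\<Sum>j<length \<alpha>. replicate_mset (\<alpha> ! j) (is ! j))"

definition QSym :: "series set" where
  "QSym = {f. (\<forall>m. 0 \<in># m \<longrightarrow> f m = 0)
    \<and> (\<exists>d. \<forall>m. d < size m \<longrightarrow> f m = 0)
    \<and> (\<forall>\<alpha> is js. 0 \<notin> set \<alpha> \<and> is \<in> index_sequences (length \<alpha>) \<and> js \<in> index_sequences (length \<alpha>)
         \<longrightarrow> f (power_product \<alpha> is) = f (power_product \<alpha> js))}"

definition monomial_qsym :: "nat list \<Rightarrow> series" where
  "monomial_qsym \<alpha> = monomial_sum (index_sequences (length \<alpha>)) (power_product \<alpha>)"

definition fundamental_qsym :: "nat list \<Rightarrow> series" where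
  "fundamental_qsym \<alpha> =
    (\<lambda>m. \<Sum>\<beta> | \<beta> \<in> compositions (sum_list \<alpha>) \<and> descent_set \<alpha> \<subseteq> descent_set \<beta>. monomial_qsym \<beta> m)"

section \<open>Multi-fundamental quasisymmetric functions\<close>

definition perm_descents :: "nat \<Rightarrow> (nat \<Rightarrow> nat) \<Rightarrow> nat set" where
  "perm_descents n w = {i. 1 \<le> i \<and> i < n \<and> w i > w (i + 1)}"

definition set_sequences :: "nat \<Rightarrow> (nat \<Rightarrow> nat) \<Rightarrow> (nat \<Rightarrow> nat set) set" where
  "set_sequences n w = {\<sigma> \<in> {1..n} \<rightarrow>\<^sub>E {S. finite S \<and> S \<noteq> {} \<and> 0 \<notin> S}.
    \<forall>i. 1 \<le> i \<and> i < n \<longrightarrow>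
      (w i < w (i + 1) \<longrightarrow> Max (\<sigma> i) \<le> Min (\<sigma> (i + 1))) \<and>
      (w i > w (i + 1) \<longrightarrow> Max (\<sigma> i) < Min (\<sigma> (i + 1)))}"

text \<open>
  The choice of the permutation is immaterial, since \<^const>\<open>set_sequences\<close> depends on it only
  through its descent set.
\<close>

definition multi_fundamental_qsym :: "nat list \<Rightarrow> series" where
  "multi_fundamental_qsym \<alpha> =
    (let n = sum_list \<alpha>;
         w = (SOME w. w permutes {1..n} \<and> perm_descents n w = descent_set \<alpha>)
     in monomial_sum (set_sequences n w) (\<lambda>\<sigma>. \<Sum>i=1..n. mset_set (\<sigma> i)))"

section \<open>The linear maps \<open>f \<mapsto> f\<^sup>(\<^sup>i\<^sup>)\<close>\<close>

text \<open>
  The coordinates of \<open>f \<in> QSym\<close> in the basis of fundamental quasisymmetric functions, which is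
  indexed by all compositions, the empty one (of \<open>0\<close>) included.
\<close>

definition fundamental_coeffs :: "series \<Rightarrow> nat list \<Rightarrow> int" where
  "fundamental_coeffs f = (THE c. finite {\<alpha>. c \<alpha> \<noteq> 0} \<and> (\<forall>\<alpha>. c \<alpha> \<noteq> 0 \<longrightarrow> 0 \<notin> set \<alpha>)
     \<and> f = (\<lambda>m. \<Sum>\<alpha> | c \<alpha> \<noteq> 0. c \<alpha> * fundamental_qsym \<alpha> m))"

definition qsym_raise :: "nat \<Rightarrow> series \<Rightarrow> series" where
  "qsym_raise i f = (\<lambda>m. \<Sum>\<alpha> | fundamental_coeffs f \<alpha> \<noteq> 0. fundamental_coeffs f \<alpha> *
     homogeneous_part (i + sum_list \<alpha>) (multi_fundamental_qsym \<alpha>) m)"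

section \<open>Extensions of subsets\<close>

definition extensions :: "nat \<Rightarrow> nat \<Rightarrow> nat set \<Rightarrow> nat set \<Rightarrow> (nat \<Rightarrow> nat) set" where
  "extensions n i D E = {t \<in> {1..n - 1} \<rightarrow>\<^sub>E {1..n + i - 1}.
     inj_on t {1..n - 1} \<and> mono_on {1..n - 1} t \<and> t ` D \<subseteq> E \<and>
     E - t ` D = {1..n + i - 1} - t ` {1..n - 1}}"

end

theory Submission
  imports Defs "HOL-Library.Infinite_Set"
begin

text \<open>
  A monomial \<open>m\<close> of degree \<open>N\<close>, written as a weakly increasing word, is recorded up to
  quasisymmetry by the set \<open>J \<subseteq> [N - 1]\<close> of its strict ascents: the coefficient of \<open>m\<close> in
  \<open>M\<^sub>\<alpha>\<close> is 1 iff \<open>J = D(\<alpha>)\<close>, and in \<open>L\<^sub>\<alpha>\<close> iff \<open>D(\<alpha>) \<subseteq> J\<close> (degrees being equal). A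
  sequence of sets contributing to \<open>m\<close> cuts this word into strictly increasing blocks; the \<open>i\<close>
  positions inside blocks form a subset \<open>K \<subseteq> J\<close>, and the block starts are enumerated by the
  increasing bijection \<open>t\<^sub>K\<close> onto the complement of \<open>K\<close>. By linearity the coefficient of \<open>m\<close>
  in \<open>f\<^sup>(\<^sup>i\<^sup>)\<close> is the sum, over the \<open>i\<close>-subsets \<open>K\<close> of \<open>J\<close>, of the coefficient of \<open>f\<close> at a
  monomial of degree \<open>N - i\<close> with ascent set the preimage of \<open>J\<close> under \<open>t\<^sub>K\<close>. An
  \<open>i\<close>-extension is the restriction of some \<open>t\<^sub>K\<close>, which gives both expansions. Finally
  \<open>t\<^sub>K \<circ> t\<^sub>K\<^sub>'\<close> is \<open>t\<^sub>U\<close> with \<open>U = K \<union> t\<^sub>K(K')\<close>, and a set \<open>U\<close> of size \<open>i + j\<close>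
  arises from exactly as many pairs as it has \<open>j\<close>-subsets \<open>K\<close>, whence the binomial coefficient.
\<close>

text \<open>If \<open>s\<close> and \<open>t\<close> agree below \<open>n\<close>, each of
  \<open>s n\<close> and \<open>t n\<close> is the least value of the common range not yet used, so
  neither can exceed the other.\<close>

lemma strict_mono_eqI:
  fixes s t :: "nat \<Rightarrow> nat"
  assumes "strict_mono s" "strict_mono t" "range s = range t"
  shows "s = t"
proof
  fix n
  show "s n = t n"
  proof (induction n rule: less_induct)
    case (less n)
    have aux: "g n \<le> f n" if f: "strict_mono f" and g: "strict_mono g" and r: "range f = range g"
      and IH: "\<And>k. k < n \<Longrightarrow> f k = g k" for f g :: "nat \<Rightarrow> nat"
    proof -
      obtain k where k: "f n = g k" using r by (metis rangeE rangeI)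
      have "\<not> k < n" using IH[of k] k f by (metis strict_mono_less less_irrefl)
      then show ?thesis using g k by (simp add: strict_mono_less_eq)
    qed
    show ?case
      using aux[of s t] aux[of t s] assms less by (simp add: order_antisym)
  qed
qed

section \<open>The increasing enumeration of a cofinite set\<close>

text \<open>This is the map t_K. Enumerating the complement in all of the naturals gives a total
  function that does not depend on the length of the word, so preimages and composites need no
  conditions on domains.\<close>

definition skip :: "nat set \<Rightarrow> nat \<Rightarrow> nat" where
  "skip K = wellorder_class.enumerate (- K)"

lemma strict_mono_skip: "finite K \<Longrightarrow> strict_mono (skip K)"
  unfolding skip_def by (simp add: strict_mono_enumerate)

lemma range_skip: "finite K \<Longrightarrow> range (skip K) = - K"
  unfolding skip_def by (simp add: range_enumerate)

lemma skip_unique: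
  assumes "strict_mono t" "range t = - K" "finite K"
  shows "t = skip K"
  using assms by (simp add: strict_mono_eqI strict_mono_skip range_skip)

lemma skip_less_iff [simp]: "finite K \<Longrightarrow> skip K x < skip K y \<longleftrightarrow> x < y"
  using strict_mono_skip by (simp add: strict_mono_less)

lemma skip_le_iff [simp]: "finite K \<Longrightarrow> skip K x \<le> skip K y \<longleftrightarrow> x \<le> y"
  using strict_mono_skip by (simp add: strict_mono_less_eq)

lemma skip_eq_iff [simp]: "finite K \<Longrightarrow> skip K x = skip K y \<longleftrightarrow> x = y"
  using strict_mono_skip by (simp add: strict_mono_eq)

lemma inj_on_skip: "finite K \<Longrightarrow> inj_on (skip K) A"
  by (simp add: inj_on_def)

lemma skip_notin: "finite K \<Longrightarrow> skip K x \<notin> K"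
  using range_skip by blast

lemma skip_surj:
  assumes "finite K" "x \<notin> K"
  obtains k where "x = skip K k"
proof -
  have "x \<in> range (skip K)" using assms by (simp add: range_skip)
  then show thesis using that by blast
qed

lemma skip_0:
  assumes "finite K" "0 \<notin> K"
  shows "skip K 0 = 0"
proof -
  obtain k where "0 = skip K k" using skip_surj[OF assms] .
  moreover have "skip K 0 \<le> skip K k" using assms(1) by simp
  ultimately show ?thesis by simp
qed

text \<open>\<open>N\<close> lies outside \<open>K\<close>, so it is a value of
  \<open>skip K\<close>; its index is the number of smaller elements outside
  \<open>K\<close>.\<close>

lemma skip_top:
  assumes "K \<subseteq> {..<N}"
  shows "skip K (N - card K) = N"
proof -
  have fin: "finite K" using assms finite_subset by blast
  have "N \<notin> K" using assms by auto
  then obtain k where k: "N = skip K k" using skip_surj[OF fin] by blast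
  have "skip K ` {..<k} = {..<N} - K"
  proof
    show "skip K ` {..<k} \<subseteq> {..<N} - K" using fin k skip_notin by auto
    show "{..<N} - K \<subseteq> skip K ` {..<k}"
    proof
      fix x assume x: "x \<in> {..<N} - K"
      then obtain j where "x = skip K j" using skip_surj[OF fin] by blast
      then show "x \<in> skip K ` {..<k}" using x k fin by auto
    qed
  qed
  then have "card ({..<N} - K) = k" using card_image[OF inj_on_skip[OF fin], of "{..<k}"] by simp
  then have "k = N - card K" using assms fin by (simp add: card_Diff_subset)
  then show ?thesis using k by simp
qed

text \<open>The endpoints 0 and \<open>N - card K\<close> are sent to 0 and \<open>N\<close>, so
  strict monotonicity confines the preimage. It is again a possible ascent set, for a word shortened
  by \<open>card K\<close>.\<close>

lemma skip_vimage_subset: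
  assumes "E \<subseteq> {0<..<N}" "K \<subseteq> E"
  shows "skip K -` E \<subseteq> {0<..<N - card K}"
proof
  fix x assume x: "x \<in> skip K -` E"
  have fin: "finite K" using assms by (meson finite_greaterThanLessThan finite_subset)
  have "0 \<notin> K" "K \<subseteq> {..<N}" using assms by auto
  then have "skip K 0 = 0" "skip K (N - card K) = N" using skip_0[OF fin] skip_top by simp_all
  moreover have "skip K x \<in> {0<..<N}" using x assms by blast
  ultimately have "skip K 0 < skip K x" "skip K x < skip K (N - card K)" by simp_all
  then show "x \<in> {0<..<N - card K}" using fin by simp
qed

text \<open>The composite is strictly increasing and misses exactly \<open>K\<close> and the image
  of \<open>K'\<close> under \<open>skip K\<close>, so uniqueness of the enumeration
  applies.\<close>

lemma skip_comp:
  assumes "finite K" "finite K'"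
  shows "skip K \<circ> skip K' = skip (K \<union> skip K ` K')"
proof (rule skip_unique)
  show "strict_mono (skip K \<circ> skip K')" using assms by (simp add: strict_mono_def)
  have "range (skip K \<circ> skip K') = skip K ` (- K')" using assms by (simp add: range_skip image_comp [symmetric] del: comp_apply)
  also have "\<dots> = range (skip K) - skip K ` K'"
    unfolding Compl_eq_Diff_UNIV using assms by (intro image_set_diff inj_on_skip)
  also have "\<dots> = - (K \<union> skip K ` K')" using range_skip assms by auto
  finally show "range (skip K \<circ> skip K') = - (K \<union> skip K ` K')" .
qed (use assms in auto)

section \<open>Removing positions in two stages\<close>

definition k_subsets :: "nat \<Rightarrow> nat set \<Rightarrow> nat set set" where
  "k_subsets k A = {K. K \<subseteq> A \<and> card K = k}"

lemma finite_k_subsets: "finite A \<Longrightarrow> finite (k_subsets k A)"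
  unfolding k_subsets_def by auto

text \<open>The summand for \<open>(K, K')\<close> depends only on the union \<open>U\<close> of
  \<open>K\<close> and the image of \<open>K'\<close> under \<open>skip K\<close>. Given
  \<open>U\<close>, any of its \<open>j\<close>-subsets may serve as \<open>K\<close> and then
  determines \<open>K'\<close>, so every \<open>U\<close> is counted a binomial number of
  times.\<close>

lemma sum_skip_skip:
  fixes g :: "nat set \<Rightarrow> int"
  assumes fin: "finite E"
  shows "(\<Sum>K\<in>k_subsets j E. \<Sum>K'\<in>k_subsets i (skip K -` E). g (skip K' -` (skip K -` E)))
    = int ((i + j) choose i) * (\<Sum>U\<in>k_subsets (i + j) E. g (skip U -` E))"
proof -
  have finK: "finite K" if "K \<in> k_subsets j E" for K
    using that fin finite_subset unfolding k_subsets_def by blast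
  have finv: "finite (skip K -` E)" if "K \<in> k_subsets j E" for K
    using finK[OF that] fin by (simp add: finite_vimageI inj_on_skip)
  have "(\<Sum>K\<in>k_subsets j E. \<Sum>K'\<in>k_subsets i (skip K -` E). g (skip K' -` (skip K -` E)))
    = (\<Sum>(K, K')\<in>Sigma (k_subsets j E) (\<lambda>K. k_subsets i (skip K -` E)). g (skip K' -` (skip K -` E)))"
    using fin finv by (intro sum.Sigma) (auto intro: finite_k_subsets)
  also have "\<dots> = (\<Sum>(U, K)\<in>Sigma (k_subsets (i + j) E) (k_subsets j). g (skip U -` E))"
  \<comment> \<open>\<open>K'\<close> is recovered from \<open>U\<close> and \<open>K\<close>
    because \<open>skip K\<close> is a bijection onto the complement of \<open>K\<close>, which
    contains \<open>U - K\<close>.\<close>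
  proof (rule sum.reindex_bij_witness[where
        i = "\<lambda>(U, K). (K, skip K -` (U - K))" and j = "\<lambda>(K, K'). (K \<union> skip K ` K', K)"], goal_cases)
    case (1 p)
    then obtain K K' where p: "p = (K, K')" "K \<in> k_subsets j E" by auto
    then have "finite K" using finK by simp
    then show ?case using p skip_notin by (auto simp: inj_on_skip)
  next
    case (2 p)
    then obtain K K' where p: "p = (K, K')" "K \<in> k_subsets j E" "K' \<in> k_subsets i (skip K -` E)" by auto
    note K = finK[OF p(2)] and finv[OF p(2)]
    then have K': "finite K'" using p finite_subset unfolding k_subsets_def by blast
    have "K \<inter> skip K ` K' = {}" using skip_notin[OF K] by auto
    then have "card (K \<union> skip K ` K') = j + i"
      using p K K' by (simp add: card_Un_disjoint card_image inj_on_skip k_subsets_def)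
    then show ?case using p by (auto simp: k_subsets_def)
  next
    case (3 p)
    then obtain U K where p: "p = (U, K)" "U \<in> k_subsets (i + j) E" "K \<in> k_subsets j U" by auto
    then have "K \<in> k_subsets j E" by (auto simp: k_subsets_def)
    note K = finK[OF this]
    then have "skip K ` (skip K -` (U - K)) = U - K" using range_skip by (simp add: image_vimage_eq) auto
    then show ?case using p by (auto simp: k_subsets_def)
  next
    case (4 p)
    then obtain U K where p: "p = (U, K)" "U \<in> k_subsets (i + j) E" "K \<in> k_subsets j U" by auto
    then have KE: "K \<in> k_subsets j E" by (auto simp: k_subsets_def)
    note K = finK[OF this]
    then have *: "skip K ` (skip K -` (U - K)) = U - K" using range_skip by (simp add: image_vimage_eq) auto
    have "card (skip K -` (U - K)) = card (U - K)"
      using card_image[OF inj_on_skip[OF K]] * by metis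
    also have "\<dots> = i" using p K by (simp add: card_Diff_subset k_subsets_def)
    finally show ?case using p KE by (auto simp: k_subsets_def)
  next
    case (5 p)
    then obtain K K' where p: "p = (K, K')" "K \<in> k_subsets j E" "K' \<in> k_subsets i (skip K -` E)" by auto
    note K = finK[OF p(2)] and finv[OF p(2)]
    then have K': "finite K'" using p finite_subset unfolding k_subsets_def by blast
    show ?case using p skip_comp[OF K K'] by (simp add: vimage_comp)
  qed
  also have "\<dots> = (\<Sum>U\<in>k_subsets (i + j) E. \<Sum>K\<in>k_subsets j U. g (skip U -` E))"
    using fin by (intro sum.Sigma[symmetric])
      (auto intro!: finite_k_subsets intro: finite_subset simp: k_subsets_def[of "i + j"])
  also have "\<dots> = (\<Sum>U\<in>k_subsets (i + j) E. int ((i + j) choose i) * g (skip U -` E))"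
  proof (rule sum.cong)
    fix U assume U: "U \<in> k_subsets (i + j) E"
    then have "finite U" using fin finite_subset unfolding k_subsets_def by blast
    then have "card (k_subsets j U) = (i + j) choose j"
      using U by (simp add: n_subsets k_subsets_def)
    also have "\<dots> = (i + j) choose i" using binomial_symmetric[of j "i + j"] by simp
    finally show "(\<Sum>K\<in>k_subsets j U. g (skip U -` E)) = int ((i + j) choose i) * g (skip U -` E)" by simp
  qed simp
  finally show ?thesis by (simp add: sum_distrib_left)
qed

section \<open>Quasisymmetric functions through ascents\<close>

text \<open>Lists are indexed from 0, so \<open>k\<close> marks the gap after the first
  \<open>k\<close> letters. With this convention the ascents of a sorted word are the proper partial
  sums of the lengths of its constant runs, as in \<open>descent_set\<close>.\<close>

definition ascents :: "nat list \<Rightarrow> nat set" where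
  "ascents xs = {k. 0 < k \<and> k < length xs \<and> xs ! (k - 1) < xs ! k}"

definition jumps :: "nat multiset \<Rightarrow> nat set" where
  "jumps m = ascents (sorted_list_of_multiset m)"

lemma jumps_mset: "sorted xs \<Longrightarrow> jumps (mset xs) = ascents xs"
  by (simp add: jumps_def sort_key_id_if_sorted)

lemma jumps_subset: "jumps m \<subseteq> {0<..<size m}"
  unfolding jumps_def ascents_def by (auto simp flip: size_mset)

lemma finite_jumps: "finite (jumps m)"
  using jumps_subset by (rule finite_subset) simp

lemma ascents_Nil [simp]: "ascents [] = {}"
  by (simp add: ascents_def)

lemma ascents_replicate [simp]: "ascents (replicate a i) = {}"
  by (auto simp: ascents_def)

text \<open>The constant run has no ascent, the strict step at the seam contributes
  \<open>a\<close>, and the rest is shifted by \<open>a\<close>. \<open>descent_set\<close>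
  satisfies the same recursion.\<close>

lemma ascents_replicate_append:
  assumes "0 < a" "ys \<noteq> []" "i < hd ys"
  shows "ascents (replicate a i @ ys) = insert a ((+) a ` ascents ys)"
proof (rule set_eqI)
  fix k
  consider "k < a" | "k = a" | l where "k = a + l" "0 < l"
    by (metis less_imp_add_positive linorder_neqE_nat)
  then show "k \<in> ascents (replicate a i @ ys) \<longleftrightarrow> k \<in> insert a ((+) a ` ascents ys)"
  proof cases
    case 1
    then show ?thesis by (auto simp: ascents_def nth_append)
  next
    case 2
    then show ?thesis using assms by (auto simp: ascents_def nth_append hd_conv_nth)
  next
    case 3
    obtain h where h: "l = Suc h" using 3 by (cases l) auto
    then have "(replicate a i @ ys) ! (k - 1) = ys ! (l - 1)" "(replicate a i @ ys) ! k = ys ! l"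
      using 3 by (simp_all add: nth_append)
    then show ?thesis using 3 by (auto simp: ascents_def)
  qed
qed

section \<open>Descent sets and the words of monomials\<close>

lemma descent_set_short [simp]: "descent_set [] = {}" "descent_set [a] = {}"
  by (auto simp: descent_set_def)

lemma descent_set_Cons:
  assumes "\<beta> \<noteq> []"
  shows "descent_set (a # \<beta>) = insert a ((+) a ` descent_set \<beta>)"
proof
  show "descent_set (a # \<beta>) \<subseteq> insert a ((+) a ` descent_set \<beta>)"
  proof
    fix x assume "x \<in> descent_set (a # \<beta>)"
    then obtain j where j: "x = sum_list (take j (a # \<beta>))" "1 \<le> j" "j < length (a # \<beta>)"
      by (auto simp: descent_set_def)
    then obtain l where l: "j = Suc l" by (cases j) auto
    show "x \<in> insert a ((+) a ` descent_set \<beta>)"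
      using j l by (cases "l = 0") (auto simp: descent_set_def intro!: imageI)
  qed
  show "insert a ((+) a ` descent_set \<beta>) \<subseteq> descent_set (a # \<beta>)"
  proof
    fix x assume "x \<in> insert a ((+) a ` descent_set \<beta>)"
    then consider "x = a" | l where "x = a + sum_list (take l \<beta>)" "1 \<le> l" "l < length \<beta>"
      by (auto simp: descent_set_def)
    then show "x \<in> descent_set (a # \<beta>)"
    proof cases
      case 1
      then show ?thesis using assms unfolding descent_set_def by (intro CollectI exI[of _ 1]) auto
    next
      case 2
      then show ?thesis unfolding descent_set_def by (intro CollectI exI[of _ "Suc l"]) auto
    qed
  qed
qed

text \<open>For increasing \<open>is\<close> of the same length as \<open>\<alpha>\<close>, this is
  the sorted word of the monomial \<open>power_product \<alpha> is\<close>.\<close>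

definition block_word :: "nat list \<Rightarrow> nat list \<Rightarrow> nat list" where
  "block_word \<alpha> is = concat (map2 replicate \<alpha> is)"

lemma block_word_simps [simp]:
  "block_word [] is = []"
  "block_word (a # \<alpha>) (i # is) = replicate a i @ block_word \<alpha> is"
  by (simp_all add: block_word_def)

lemma power_product_block_word:
  "length \<alpha> = length is \<Longrightarrow> power_product \<alpha> is = mset (block_word \<alpha> is)"
  by (induction \<alpha> "is" rule: list_induct2)
    (simp_all add: power_product_def sum.lessThan_Suc_shift del: sum.lessThan_Suc)

text \<open>The facts are proved jointly because the induction uses them together: the letter set
  gives sortedness across the seam, and the head shows that the seam is a strict ascent.\<close>

lemma block_word:
  assumes "length \<alpha> = length is" "0 \<notin> set \<alpha>" "sorted_wrt (<) is"
  shows "sorted (block_word \<alpha> is) \<and> ascents (block_word \<alpha> is) = descent_set \<alpha>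
    \<and> set (block_word \<alpha> is) = set is \<and> length (block_word \<alpha> is) = sum_list \<alpha>
    \<and> (is \<noteq> [] \<longrightarrow> block_word \<alpha> is \<noteq> [] \<and> hd (block_word \<alpha> is) = hd is)"
  using assms
proof (induction \<alpha> "is" rule: list_induct2)
  case Nil
  then show ?case by simp
next
  case (Cons a \<alpha> i "is")
  let ?w = "block_word \<alpha> is"
  have IH: "sorted ?w" "ascents ?w = descent_set \<alpha>" "set ?w = set is" "length ?w = sum_list \<alpha>"
    "is \<noteq> [] \<longrightarrow> ?w \<noteq> [] \<and> hd ?w = hd is"
    using Cons by auto
  have a: "0 < a" using Cons.prems by auto
  have "ascents (replicate a i @ ?w) = descent_set (a # \<alpha>)"
  proof (cases "is = []")
    case True
    then show ?thesis using Cons.hyps by simp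
  next
    case False
    then have "\<alpha> \<noteq> []" "?w \<noteq> []" "hd ?w = hd is" using Cons.hyps IH(5) by auto
    moreover have "i < hd is" using False Cons.prems by auto
    ultimately show ?thesis using a by (simp add: ascents_replicate_append descent_set_Cons IH(2))
  qed
  moreover have "sorted (replicate a i @ ?w)"
    using IH(1,3) Cons.prems by (auto simp: sorted_append less_imp_le)
  ultimately show ?case using a IH(3,4) by (auto simp: hd_append)
qed

lemma power_product:
  assumes "0 \<notin> set \<alpha>" "is \<in> index_sequences (length \<alpha>)"
  shows "jumps (power_product \<alpha> is) = descent_set \<alpha>" "set_mset (power_product \<alpha> is) = set is"
    "size (power_product \<alpha> is) = sum_list \<alpha>" "0 \<notin># power_product \<alpha> is"
proof -
  have len: "length \<alpha> = length is" and s: "sorted_wrt (<) is" and z: "0 \<notin> set is"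
    using assms(2) by (auto simp: index_sequences_def)
  note b = block_word[OF len assms(1) s] power_product_block_word[OF len]
  show "jumps (power_product \<alpha> is) = descent_set \<alpha>" "set_mset (power_product \<alpha> is) = set is"
    "size (power_product \<alpha> is) = sum_list \<alpha>" "0 \<notin># power_product \<alpha> is"
    using b z by (simp_all add: jumps_mset)
qed

lemma inj_on_power_product:
  assumes "0 \<notin> set \<alpha>"
  shows "inj_on (power_product \<alpha>) (index_sequences (length \<alpha>))"
proof (rule inj_onI)
  fix "is" js
  assume i: "is \<in> index_sequences (length \<alpha>)" and j: "js \<in> index_sequences (length \<alpha>)"
    and eq: "power_product \<alpha> is = power_product \<alpha> js"
  have "set is = set js" using power_product(2)[OF assms] i j eq by metis
  then show "is = js"
    using i j by (auto simp: index_sequences_def strict_sorted_iff intro: sorted_distinct_set_unique)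
qed

text \<open>Take the distinct variables of \<open>m\<close> in increasing order as \<open>is\<close>
  and their multiplicities as \<open>\<alpha>\<close>.\<close>

lemma power_product_exhaust:
  assumes "0 \<notin># m"
  obtains \<alpha> "is" where "0 \<notin> set \<alpha>" "is \<in> index_sequences (length \<alpha>)" "m = power_product \<alpha> is"
proof -
  define js where "js = sorted_list_of_set (set_mset m)"
  define \<alpha> where "\<alpha> = map (count m) js"
  have js: "set js = set_mset m" "distinct js" "sorted_wrt (<) js" by (auto simp: js_def)
  have 1: "0 \<notin> set \<alpha>" by (auto simp: \<alpha>_def js simp flip: not_in_iff)
  have 2: "js \<in> index_sequences (length \<alpha>)" using js assms by (auto simp: index_sequences_def \<alpha>_def)
  have "power_product \<alpha> js = (\<Sum>j<length js. replicate_mset (count m (js ! j)) (js ! j))"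
    by (simp add: power_product_def \<alpha>_def)
  also have "\<dots> = sum_list (map (\<lambda>x. replicate_mset (count m x) x) js)"
    by (simp add: sum_list_sum_nth atLeast0LessThan)
  also have "\<dots> = (\<Sum>x\<in>set_mset m. replicate_mset (count m x) x)"
    using js by (simp add: sum_list_distinct_conv_sum_set)
  also have "\<dots> = m"
  proof (rule multiset_eqI)
    fix x
    have "count (\<Sum>x\<in>set_mset m. replicate_mset (count m x) x) x
      = (\<Sum>y\<in>set_mset m. if y = x then count m x else 0)"
      by (simp add: count_sum)
    also have "\<dots> = count m x" by (auto simp: not_in_iff)
    finally show "count (\<Sum>x\<in>set_mset m. replicate_mset (count m x) x) x = count m x" .
  qed
  finally show thesis using that[OF 1 2] by simp
qed

lemma descent_set_pos:
  assumes "0 \<notin> set \<alpha>" "x \<in> descent_set \<alpha>"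
  shows "0 < x"
proof (cases \<alpha>)
  case (Cons a \<beta>)
  then show ?thesis using assms by (cases "\<beta> = []") (auto simp: descent_set_Cons)
qed (use assms in simp)

lemma descent_set_inj:
  assumes "0 \<notin> set \<alpha>" "0 \<notin> set \<beta>" "sum_list \<alpha> = sum_list \<beta>" "descent_set \<alpha> = descent_set \<beta>"
  shows "\<alpha> = \<beta>"
  using assms
proof (induction \<alpha> arbitrary: \<beta>)
  case Nil
  then show ?case by (cases \<beta>) auto
next
  case (Cons a \<alpha>)
  obtain b \<beta>' where \<beta>: "\<beta> = b # \<beta>'" using Cons.prems by (cases \<beta>) auto
  have ne: "descent_set (c # \<gamma>) \<noteq> {} \<longleftrightarrow> \<gamma> \<noteq> []" for c \<gamma>
    by (cases "\<gamma> = []") (auto simp: descent_set_Cons)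
  show ?case
  proof (cases "\<alpha> = []")
    case True
    then have "\<beta>' = []" using Cons.prems(4) ne \<beta> by metis
    then show ?thesis using True \<beta> Cons.prems by simp
  next
    case False
    then have ne': "\<beta>' \<noteq> []" using Cons.prems(4) ne \<beta> by metis
    have D: "insert a ((+) a ` descent_set \<alpha>) = insert b ((+) b ` descent_set \<beta>')"
      using Cons.prems(4) False ne' \<beta> by (simp add: descent_set_Cons)
    have pos: "0 \<notin> descent_set \<alpha>" "0 \<notin> descent_set \<beta>'"
      using descent_set_pos Cons.prems \<beta> by force+
    \<comment> \<open>All members of each set are at least its first part, so these memberships give
      \<open>b \<le> a\<close> and \<open>a \<le> b\<close>.\<close>
    have "a \<in> insert b ((+) b ` descent_set \<beta>')" "b \<in> insert a ((+) a ` descent_set \<alpha>)"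
      using D by auto
    then have "a = b" by auto
    \<comment> \<open>Positivity keeps the first part out of the shifted set, so it can be removed
      from both sides.\<close>
    moreover have "a \<notin> (+) a ` descent_set \<alpha>" "b \<notin> (+) b ` descent_set \<beta>'" using pos by auto
    ultimately have "(+) a ` descent_set \<alpha> = (+) a ` descent_set \<beta>'" using D by (metis insert_ident)
    then have "descent_set \<alpha> = descent_set \<beta>'" by (simp add: inj_image_eq_iff)
    then show ?thesis using Cons \<beta> \<open>a = b\<close> by auto
  qed
qed

section \<open>Canonical monomials and the bijection between compositions and sets\<close>

text \<open>A canonical monomial of degree \<open>n\<close> with ascent set \<open>A\<close>, for
  \<open>A\<close> inside the allowed positions: the letter grows by one exactly at the elements of
  \<open>A\<close>. \<open>Suc\<close> keeps out the forbidden variable 0.\<close>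

definition staircase :: "nat \<Rightarrow> nat set \<Rightarrow> nat multiset" where
  "staircase n A = mset (map (\<lambda>k. Suc (card (A \<inter> {..k}))) [0..<n])"

lemma staircase:
  shows size_staircase [simp]: "size (staircase n A) = n"
    and zero_notin_staircase [simp]: "0 \<notin># staircase n A"
    and jumps_staircase: "A \<subseteq> {0<..<n} \<Longrightarrow> jumps (staircase n A) = A"
proof -
  let ?xs = "map (\<lambda>k. Suc (card (A \<inter> {..k}))) [0..<n]"
  show "size (staircase n A) = n" "0 \<notin># staircase n A" by (auto simp: staircase_def)
  assume A: "A \<subseteq> {0<..<n}"
  have "sorted ?xs" by (auto simp: sorted_iff_nth_mono intro!: card_mono)
  then have "jumps (staircase n A) = ascents ?xs" unfolding staircase_def by (rule jumps_mset)
  also have "\<dots> = A"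
  proof (rule set_eqI)
    fix k
    show "k \<in> ascents ?xs \<longleftrightarrow> k \<in> A"
    proof (cases "0 < k \<and> k < n")
      case True
      then obtain l where l: "k = Suc l" by (cases k) auto
      have "A \<inter> {..k} = (if k \<in> A then insert k (A \<inter> {..l}) else A \<inter> {..l})"
        using l by (auto simp: le_Suc_eq)
      then have "card (A \<inter> {..k}) = (if k \<in> A then Suc (card (A \<inter> {..l})) else card (A \<inter> {..l}))"
        using l by simp
      then show ?thesis using True l by (simp add: ascents_def)
    next
      case False
      then show ?thesis using A by (auto simp: ascents_def)
    qed
  qed
  finally show "jumps (staircase n A) = A" .
qed

lemma descent_set_subset:
  assumes "\<alpha> \<in> compositions n"
  shows "descent_set \<alpha> \<subseteq> {0<..<n}"
proof -
  \<comment> \<open>Any monomial with exponents \<open>\<alpha>\<close> realizes the descent set as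
    its \<open>jumps\<close>, for which the bound is known; the first variables serve as an
    example.\<close>
  have "[1..<Suc (length \<alpha>)] \<in> index_sequences (length \<alpha>)"
    by (simp add: index_sequences_def strict_sorted_iff del: upt_Suc)
  from power_product(1,3)[OF _ this] show ?thesis
    using assms jumps_subset by (metis (mono_tags, lifting) compositions_def mem_Collect_eq)
qed

text \<open>For surjectivity, the exponent list of the staircase monomial of \<open>A\<close> is a
  composition with descent set \<open>A\<close>.\<close>

lemma bij_betw_descent_set: "bij_betw descent_set (compositions n) (Pow {0<..<n})"
  unfolding bij_betw_def
proof (intro conjI subset_antisym subsetI)
  show "inj_on descent_set (compositions n)"
    by (auto simp: inj_on_def compositions_def intro: descent_set_inj)
  fix A assume A: "A \<in> Pow {0<..<n}"
  obtain \<alpha> "is" where "0 \<notin> set \<alpha>" "is \<in> index_sequences (length \<alpha>)" "staircase n A = power_product \<alpha> is"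
    using power_product_exhaust zero_notin_staircase by metis
  with power_product[of \<alpha> "is"] A jumps_staircase[of A n] size_staircase[of n A]
  have "descent_set \<alpha> = A" "\<alpha> \<in> compositions n" by (auto simp: compositions_def)
  then show "A \<in> descent_set ` compositions n" by auto
qed (use descent_set_subset in auto)

lemma composition_of_set:
  assumes "A \<subseteq> {0<..<n}"
  shows "composition_of_set n A \<in> compositions n" "descent_set (composition_of_set n A) = A"
proof -
  have "A \<in> descent_set ` compositions n" "inj_on descent_set (compositions n)"
    using bij_betw_descent_set[of n] assms by (auto simp: bij_betw_def)
  then show "composition_of_set n A \<in> compositions n" "descent_set (composition_of_set n A) = A"
    unfolding composition_of_set_def by (auto simp: f_the_inv_into_f intro: the_inv_into_into)
qed

lemma finite_compositions: "finite (compositions n)"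
  using bij_betw_finite[OF bij_betw_descent_set] by simp

section \<open>Coefficients of the two bases and membership in \<open>QSym\<close>\<close>

text \<open>At most one index sequence produces \<open>m\<close>, so the coefficient is 0 or 1. It
  is 1 when the exponent list of \<open>m\<close> is \<open>\<alpha>\<close>, and by
  \<open>descent_set_inj\<close> degree and ascents detect this.\<close>

lemma monomial_qsym_eq:
  assumes "\<alpha> \<in> compositions n"
  shows "monomial_qsym \<alpha> m = of_bool (0 \<notin># m \<and> size m = n \<and> jumps m = descent_set \<alpha>)"
proof -
  have \<alpha>: "0 \<notin> set \<alpha>" "sum_list \<alpha> = n" using assms by (auto simp: compositions_def)
  let ?S = "{is \<in> index_sequences (length \<alpha>). power_product \<alpha> is = m}"
  show ?thesis
  proof (cases "?S = {}")
    case True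
    have "\<not> (0 \<notin># m \<and> size m = n \<and> jumps m = descent_set \<alpha>)"
    proof
      assume m: "0 \<notin># m \<and> size m = n \<and> jumps m = descent_set \<alpha>"
      obtain \<beta> "is" where b: "0 \<notin> set \<beta>" "is \<in> index_sequences (length \<beta>)" "m = power_product \<beta> is"
        using power_product_exhaust m by metis
      then have "\<alpha> = \<beta>" using power_product[OF b(1,2)] m \<alpha> by (intro descent_set_inj) auto
      then show False using b True by auto
    qed
    moreover have "monomial_qsym \<alpha> m = int (card ?S)" by (simp add: monomial_qsym_def monomial_sum_def)
    ultimately show ?thesis unfolding True by simp
  next
    case False
    then obtain "is" where i: "is \<in> index_sequences (length \<alpha>)" "power_product \<alpha> is = m" by auto
    then have "?S = {is}" using inj_on_power_product[OF \<alpha>(1)] by (auto dest: inj_onD)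
    then show ?thesis using power_product[OF \<alpha>(1) i(1)] i(2) \<alpha>(2)
      by (simp add: monomial_qsym_def monomial_sum_def)
  qed
qed

text \<open>Just one composition of \<open>n\<close> has descent set \<open>jumps m\<close> when
  \<open>m\<close> has degree \<open>n\<close>, so at most one term of the defining sum
  survives.\<close>

lemma fundamental_qsym_eq:
  assumes "\<alpha> \<in> compositions n"
  shows "fundamental_qsym \<alpha> m = of_bool (0 \<notin># m \<and> size m = n \<and> descent_set \<alpha> \<subseteq> jumps m)"
proof -
  have n: "sum_list \<alpha> = n" using assms by (auto simp: compositions_def)
  have "fundamental_qsym \<alpha> m = (\<Sum>\<beta> | \<beta> \<in> compositions n \<and> descent_set \<alpha> \<subseteq> descent_set \<beta>.
      of_bool (0 \<notin># m \<and> size m = n \<and> jumps m = descent_set \<beta>))"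
    unfolding fundamental_qsym_def n by (intro sum.cong) (auto simp: monomial_qsym_eq)
  also have "\<dots> = of_bool (0 \<notin># m \<and> size m = n \<and> descent_set \<alpha> \<subseteq> jumps m)"
  proof (cases "0 \<notin># m \<and> size m = n")
    case True
    define \<gamma> where "\<gamma> = composition_of_set n (jumps m)"
    have \<gamma>: "\<gamma> \<in> compositions n" "descent_set \<gamma> = jumps m"
      using composition_of_set[of "jumps m" n] jumps_subset[of m] True by (simp_all add: \<gamma>_def)
    have "inj_on descent_set (compositions n)" using bij_betw_descent_set by (rule bij_betw_imp_inj_on)
    then have "jumps m = descent_set \<beta> \<longleftrightarrow> \<beta> = \<gamma>" if "\<beta> \<in> compositions n" for \<beta>
      using \<gamma> that by (metis inj_onD)
    then have "(\<Sum>\<beta> | \<beta> \<in> compositions n \<and> descent_set \<alpha> \<subseteq> descent_set \<beta>.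
        of_bool (0 \<notin># m \<and> size m = n \<and> jumps m = descent_set \<beta>))
      = (\<Sum>\<beta> | \<beta> \<in> compositions n \<and> descent_set \<alpha> \<subseteq> descent_set \<beta>. if \<beta> = \<gamma> then 1 else (0::int))"
      using True by (intro sum.cong) auto
    also have "\<dots> = of_bool (descent_set \<alpha> \<subseteq> jumps m)" using \<gamma> finite_compositions by simp
    finally show ?thesis using True by simp
  qed auto
  finally show ?thesis .
qed

text \<open>Equal degrees and equal ascents force equal exponent lists, so the defining condition of
  quasisymmetry applies. \<open>QSymI\<close> is the converse criterion.\<close>

lemma QSym_cong:
  assumes "f \<in> QSym" "size m = size m'" "jumps m = jumps m'" "0 \<notin># m" "0 \<notin># m'"
  shows "f m = f m'"
proof -
  obtain \<alpha> "is" where a: "0 \<notin> set \<alpha>" "is \<in> index_sequences (length \<alpha>)" "m = power_product \<alpha> is"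
    using power_product_exhaust assms by metis
  obtain \<beta> js where b: "0 \<notin> set \<beta>" "js \<in> index_sequences (length \<beta>)" "m' = power_product \<beta> js"
    using power_product_exhaust assms by metis
  have "\<alpha> = \<beta>"
    using power_product[OF a(1,2)] power_product[OF b(1,2)] a b assms by (intro descent_set_inj) auto
  moreover have "\<forall>\<alpha> is js. 0 \<notin> set \<alpha> \<and> is \<in> index_sequences (length \<alpha>) \<and> js \<in> index_sequences (length \<alpha>)
      \<longrightarrow> f (power_product \<alpha> is) = f (power_product \<alpha> js)"
    using assms(1) unfolding QSym_def by blast
  ultimately show ?thesis using a b by blast
qed

lemma QSymI:
  assumes "\<And>m. 0 \<in># m \<Longrightarrow> f m = 0" "\<And>m. d < size m \<Longrightarrow> f m = 0"
    "\<And>m m'. \<lbrakk>0 \<notin># m; 0 \<notin># m'; size m = size m'; jumps m = jumps m'\<rbrakk> \<Longrightarrow> f m = f m'"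
  shows "f \<in> QSym"
  unfolding QSym_def
proof (intro CollectI conjI exI[of _ d] allI impI)
  fix \<alpha> "is" js :: "nat list"
  assume "0 \<notin> set \<alpha> \<and> is \<in> index_sequences (length \<alpha>) \<and> js \<in> index_sequences (length \<alpha>)"
  then show "f (power_product \<alpha> is) = f (power_product \<alpha> js)"
    by (intro assms(3)) (simp_all add: power_product(1,3,4))
qed (use assms in auto)

lemma QSym_staircase:
  assumes "f \<in> QSym" "0 \<notin># m"
  shows "f m = f (staircase (size m) (jumps m))"
  using assms by (intro QSym_cong) (auto simp: jumps_staircase jumps_subset)

lemma monomial_qsym_QSym: "0 \<notin> set \<alpha> \<Longrightarrow> monomial_qsym \<alpha> \<in> QSym"
  by (rule QSymI[where d = "sum_list \<alpha>"]) (simp_all add: monomial_qsym_eq[of _ "sum_list \<alpha>"] compositions_def)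

lemma fundamental_qsym_QSym: "0 \<notin> set \<alpha> \<Longrightarrow> fundamental_qsym \<alpha> \<in> QSym"
  by (rule QSymI[where d = "sum_list \<alpha>"]) (simp_all add: fundamental_qsym_eq[of _ "sum_list \<alpha>"] compositions_def)

section \<open>Multi-fundamental quasisymmetric functions\<close>

text \<open>Ensures that the choice operator in \<open>multi_fundamental_qsym\<close> yields a
  permutation with the required descents.\<close>

lemma permutation_with_descents:
  assumes D: "D \<subseteq> {0<..<n}"
  shows "\<exists>w. w permutes {1..n} \<and> perm_descents n w = D"
proof -
  \<comment> \<open>\<open>v\<close> increases by 1 at a non-descent and drops by \<open>n - 1 > 0\<close> at a descent; \<open>w\<close> is its standardization.\<close>
  define v where "v k = k + n * card (D \<inter> {k..})" for k
  define w where "w k = (if k \<in> {1..n} then card {j \<in> {1..n}. v j \<le> v k} else k)" for k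
  have fin: "finite D" using D finite_subset by blast
  have less: "w k < w l" if "k \<in> {1..n}" "l \<in> {1..n}" "v k < v l" for k l
  proof -
    have "card {j \<in> {1..n}. v j \<le> v k} < card {j \<in> {1..n}. v j \<le> v l}"
    proof (rule psubset_card_mono)
      have "l \<in> {j \<in> {1..n}. v j \<le> v l}" "l \<notin> {j \<in> {1..n}. v j \<le> v k}" using that by auto
      moreover have "{j \<in> {1..n}. v j \<le> v k} \<subseteq> {j \<in> {1..n}. v j \<le> v l}" using that by auto
      ultimately show "{j \<in> {1..n}. v j \<le> v k} \<subset> {j \<in> {1..n}. v j \<le> v l}" by blast
    qed simp
    then show ?thesis using that by (simp add: w_def)
  qed
  have eq: "k = l" if "k \<in> {1..n}" "l \<in> {1..n}" "v k = v l" for k l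
  proof -
    \<comment> \<open>\<open>v j\<close> is congruent to \<open>j\<close> modulo \<open>n\<close>;
      both are lowered by one because residues start at 0 and positions at 1. Hence \<open>v\<close>
      is injective on the positions.\<close>
    have mod: "(v j - 1) mod n = j - 1" if j: "j \<in> {1..n}" for j
    proof -
      have "v j - 1 = (j - 1) + n * card (D \<inter> {j..})" using j by (simp add: v_def)
      moreover have "j - 1 < n" using j by auto
      ultimately show ?thesis by (simp only: mod_mult_self2 mod_less)
    qed
    have "k - 1 = l - 1" using mod[OF that(1)] mod[OF that(2)] that(3) by simp
    moreover have "1 \<le> k" "1 \<le> l" using that(1,2) by simp_all
    ultimately show ?thesis by linarith
  qed
  have inj: "inj_on w {1..n}"
  proof (rule inj_onI)
    fix k l assume kl: "k \<in> {1..n}" "l \<in> {1..n}" "w k = w l"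
    show "k = l"
      using less[OF kl(1,2)] less[OF kl(2,1)] eq[OF kl(1,2)] kl(3)
      by (cases "v k" "v l" rule: linorder_cases) auto
  qed
  have "w k \<in> {1..n}" if "k \<in> {1..n}" for k
  proof -
    have "card {j \<in> {1..n}. v j \<le> v k} \<le> card {1..n}" by (rule card_mono) auto
    moreover have "0 < card {j \<in> {1..n}. v j \<le> v k}" using that by (auto simp: card_gt_0_iff)
    ultimately show ?thesis using that by (simp add: w_def)
  qed
  then have "w ` {1..n} = {1..n}" using inj by (intro endo_inj_surj) auto
  then have "w permutes {1..n}" using inj by (intro bij_imp_permutes) (auto simp: bij_betw_def w_def)
  moreover have "w k > w (k + 1) \<longleftrightarrow> k \<in> D" if k: "0 < k" "k < n" for k
  proof -
    have *: "D \<inter> {k..} = (if k \<in> D then insert k (D \<inter> {Suc k..}) else D \<inter> {Suc k..})"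
      by (auto simp: Suc_le_eq order.order_iff_strict)
    have **: "card (D \<inter> {k..}) = (if k \<in> D then Suc (card (D \<inter> {Suc k..})) else card (D \<inter> {Suc k..}))"
      unfolding * using fin by simp
    show ?thesis
    proof (cases "k \<in> D")
      case True
      then have "v (k + 1) < v k" unfolding v_def ** using k by simp
      then show ?thesis using less[of "k + 1" k] k True by simp
    next
      case False
      then have "v k < v (k + 1)" unfolding v_def ** by simp
      then show ?thesis using less[of k "k + 1"] k False by simp
    qed
  qed
  then have "perm_descents n w = D" using D by (auto simp: perm_descents_def Suc_le_eq)
  ultimately show ?thesis by blast
qed

section \<open>Set sequences governed by a descent set\<close>

text \<open>Pairwise comparison of elements avoids \<open>Max\<close> and \<open>Min\<close>, and of
  the permutation only the descent set remains.\<close>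

definition set_chains :: "nat \<Rightarrow> nat set \<Rightarrow> (nat \<Rightarrow> nat set) set" where
  "set_chains n D = {\<sigma> \<in> {1..n} \<rightarrow>\<^sub>E {S. finite S \<and> S \<noteq> {} \<and> 0 \<notin> S}.
    \<forall>k\<in>{0<..<n}. \<forall>a\<in>\<sigma> k. \<forall>b\<in>\<sigma> (Suc k). a \<le> b \<and> (k \<in> D \<longrightarrow> a < b)}"

text \<open>For finite nonempty sets, comparing \<open>Max\<close> with \<open>Min\<close> amounts
  to comparing all pairs of elements. Injectivity of \<open>w\<close> makes every position either an
  ascent or a descent.\<close>

lemma set_sequences_eq_set_chains:
  assumes w: "w permutes {1..n}"
  shows "set_sequences n w = set_chains n (perm_descents n w)"
proof -
  have eq: "(\<forall>i. 1 \<le> i \<and> i < n \<longrightarrow>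
      (w i < w (i + 1) \<longrightarrow> Max (\<sigma> i) \<le> Min (\<sigma> (i + 1))) \<and>
      (w i > w (i + 1) \<longrightarrow> Max (\<sigma> i) < Min (\<sigma> (i + 1)))) \<longleftrightarrow>
    (\<forall>k\<in>{0<..<n}. \<forall>a\<in>\<sigma> k. \<forall>b\<in>\<sigma> (Suc k). a \<le> b \<and> (k \<in> perm_descents n w \<longrightarrow> a < b))"
    (is "(\<forall>i. _ i \<longrightarrow> ?P i) \<longleftrightarrow> (\<forall>k\<in>_. ?Q k)")
    if \<sigma>: "\<sigma> \<in> {1..n} \<rightarrow>\<^sub>E {S. finite S \<and> S \<noteq> {} \<and> 0 \<notin> S}" for \<sigma>
  proof -
    have PQ: "?P i \<longleftrightarrow> ?Q i" if i: "1 \<le> i" "i < n" for i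
    proof -
      have S: "finite (\<sigma> i)" "\<sigma> i \<noteq> {}" "finite (\<sigma> (Suc i))" "\<sigma> (Suc i) \<noteq> {}"
        using \<sigma> i by (auto simp: PiE_iff Suc_le_eq)
      have le: "Max (\<sigma> i) \<le> Min (\<sigma> (Suc i)) \<longleftrightarrow> (\<forall>a\<in>\<sigma> i. \<forall>b\<in>\<sigma> (Suc i). a \<le> b)"
        using S by auto
      have lt: "Max (\<sigma> i) < Min (\<sigma> (Suc i)) \<longleftrightarrow> (\<forall>a\<in>\<sigma> i. \<forall>b\<in>\<sigma> (Suc i). a < b)"
        using S by auto
      have ne: "w i \<noteq> w (Suc i)" using permutes_inj[OF w] by (metis injD n_not_Suc_n)
      show ?thesis
      proof (cases "i \<in> perm_descents n w")
        case True
        then show ?thesis using lt less_imp_le by (simp add: perm_descents_def) blast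
      next
        case False
        then have "w i < w (Suc i)" using ne i by (simp add: perm_descents_def)
        then show ?thesis using le False by simp
      qed
    qed
    have ball: "(\<forall>k\<in>{0<..<n}. R k) \<longleftrightarrow> (\<forall>k. 1 \<le> k \<and> k < n \<longrightarrow> R k)" for R
      by (auto simp: Suc_le_eq)
    show ?thesis unfolding ball
    proof (intro iff_allI imp_cong refl)
      fix i assume "1 \<le> i \<and> i < n"
      then show "?P i \<longleftrightarrow> ?Q i" by (intro PQ) simp_all
    qed
  qed
  show ?thesis unfolding set_sequences_def set_chains_def by (intro Collect_cong conj_cong refl eq)
qed

lemma sum_mset_set_blocks:
  fixes t :: "nat \<Rightarrow> nat"
  assumes "mono t" "t 0 = 0"
  shows "(\<Sum>i=1..n. mset_set {t (i - 1)..<t i}) = mset_set {..<t n}"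
proof (induction n)
  case (Suc n)
  have "{..<t (Suc n)} = {..<t n} \<union> {t n..<t (Suc n)}" using monoD[OF assms(1), of n "Suc n"] by auto
  moreover have "{..<t n} \<inter> {t n..<t (Suc n)} = {}" by auto
  ultimately have "mset_set {..<t (Suc n)} = mset_set {..<t n} + mset_set {t n..<t (Suc n)}"
    by (simp only: mset_set_Union finite_lessThan finite_atLeastLessThan)
  then show ?case using Suc by simp
qed (use assms in simp)

lemma block_of_position:
  fixes t :: "nat \<Rightarrow> nat"
  assumes "t 0 = 0" "p < t n"
  shows "\<exists>k<n. t k \<le> p \<and> p < t (Suc k)"
  using assms
proof (induction n)
  case (Suc n)
  then show ?case by (cases "p < t n") (auto simp: less_Suc_eq not_less)
qed simp

section \<open>Cutting a sorted word into strictly increasing blocks\<close>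

context
  fixes n :: nat and D :: "nat set" and m :: "nat multiset" and xs :: "nat list"
  assumes D: "D \<subseteq> {0<..<n}" and xs: "sorted xs" "mset xs = m" "0 \<notin> set xs" and n: "n \<le> length xs"
begin

text \<open>\<open>K\<close> collects the positions that do not start a block, and
  \<open>skip K\<close> enumerates the starts. The condition on \<open>D\<close> demands a strict
  step of the word wherever a descent separates two blocks.\<close>

definition admissible :: "nat set set" where
  "admissible = {K \<in> k_subsets (length xs - n) (ascents xs). D \<subseteq> skip K -` ascents xs}"

text \<open>The index shift arises because blocks are numbered from 1 and starts from 0. The
  restriction makes the function extensional, as \<open>set_chains\<close> requires.\<close>

definition blocks :: "nat set \<Rightarrow> nat \<Rightarrow> nat set" where
  "blocks K = (\<lambda>i\<in>{1..n}. (!) xs ` {skip K (i - 1)..<skip K i})"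

lemma admissible:
  assumes "K \<in> admissible"
  shows "K \<subseteq> {0<..<length xs}" "finite K" "skip K 0 = 0" "skip K n = length xs"
proof -
  show 1: "K \<subseteq> {0<..<length xs}" using assms unfolding admissible_def k_subsets_def ascents_def by auto
  then show 2: "finite K" using finite_subset by blast
  show "skip K 0 = 0" using 1 2 by (intro skip_0) auto
  have "K \<subseteq> {..<length xs}" using 1 by auto
  moreover have "length xs - card K = n" using assms n by (auto simp: admissible_def k_subsets_def)
  ultimately show "skip K n = length xs" using skip_top by metis
qed

lemma skip_le_length:
  assumes "K \<in> admissible" "k \<le> n"
  shows "skip K k \<le> length xs"
  using admissible[OF assms(1)] assms(2) by (metis skip_le_iff)

text \<open>No value of \<open>skip K\<close> lies strictly between two consecutive ones, so a
  position inside a block other than its start belongs to \<open>K\<close> and is an ascent.\<close>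

lemma nth_less_in_block:
  assumes K: "K \<in> admissible" and i: "i \<in> {1..n}" and p: "skip K (i - 1) \<le> p" "p < q" "q < skip K i"
  shows "xs ! p < xs ! q"
proof -
  have "q \<in> K"
  proof (rule ccontr)
    assume "q \<notin> K"
    then obtain k where "q = skip K k" using skip_surj admissible(2)[OF K] by metis
    then have "i - 1 < k" "k < i" using p admissible(2)[OF K] by (metis le_less_trans skip_less_iff)+
    then show False by simp
  qed
  then have "xs ! (q - 1) < xs ! q" "q < length xs"
    using K by (auto simp: admissible_def k_subsets_def ascents_def)
  moreover have "xs ! p \<le> xs ! (q - 1)" using p \<open>q < length xs\<close> by (intro sorted_nth_mono xs) auto
  ultimately show ?thesis by simp
qed

lemma inj_on_block:
  assumes "K \<in> admissible" "i \<in> {1..n}"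
  shows "inj_on ((!) xs) {skip K (i - 1)..<skip K i}"
  using nth_less_in_block[OF assms] by (intro linorder_inj_onI) fastforce+

text \<open>The letters of a block are distinct, so passing from a multiset to a set loses nothing,
  and the blocks, which tile the word, add up to \<open>m\<close>.\<close>

lemma blocks_set_chains:
  assumes K: "K \<in> admissible"
  shows "blocks K \<in> set_chains n D" "(\<Sum>i=1..n. mset_set (blocks K i)) = m"
proof -
  note K' = admissible[OF K]
  have "xs ! p \<in> set xs" if "i \<in> {1..n}" "p < skip K i" for i p
    using skip_le_length[OF K, of i] that by auto
  then have "0 \<notin> (!) xs ` {skip K (i - 1)..<skip K i}" if "i \<in> {1..n}" for i
    using xs(3) that by fastforce
  then have 1: "blocks K \<in> {1..n} \<rightarrow>\<^sub>E {S. finite S \<and> S \<noteq> {} \<and> 0 \<notin> S}"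
    using K'(2) by (auto simp: blocks_def)
  have 2: "a \<le> b \<and> (k \<in> D \<longrightarrow> a < b)"
    if k: "k \<in> {0<..<n}" and ab: "a \<in> blocks K k" "b \<in> blocks K (Suc k)" for k a b
  proof -
    have "blocks K k = (!) xs ` {skip K (k - 1)..<skip K k}"
      "blocks K (Suc k) = (!) xs ` {skip K k..<skip K (Suc k)}" using k by (simp_all add: blocks_def)
    then obtain p q where p: "a = xs ! p" "p < skip K k" and q: "b = xs ! q" "skip K k \<le> q" "q < skip K (Suc k)"
      using ab by auto
    have q': "q < length xs" using skip_le_length[OF K, of "Suc k"] q k by simp
    have "a \<le> b" using p q q' by (auto intro: sorted_nth_mono xs)
    \<comment> \<open>With \<open>s = skip K k\<close> the start of the later block, the chain is
      \<open>xs ! p \<le> xs ! (s - 1) < xs ! s \<le> xs ! q\<close>.\<close>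
    moreover have "a < b" if "k \<in> D"
    proof -
      have "xs ! (skip K k - 1) < xs ! skip K k" using that K by (auto simp: admissible_def ascents_def)
      moreover have "xs ! p \<le> xs ! (skip K k - 1)" using p q q' by (intro sorted_nth_mono xs) auto
      moreover have "xs ! skip K k \<le> xs ! q" using p q q' by (intro sorted_nth_mono xs) auto
      ultimately show ?thesis using p q by simp
    qed
    ultimately show ?thesis by blast
  qed
  show "blocks K \<in> set_chains n D"
    unfolding set_chains_def by (intro CollectI conjI ballI 1) (use 2 in blast)+
  have "(\<Sum>i=1..n. mset_set (blocks K i))
    = (\<Sum>i=1..n. image_mset ((!) xs) (mset_set {skip K (i - 1)..<skip K i}))"
  proof (intro sum.cong refl)
    fix i assume i: "i \<in> {1..n}"
    then show "mset_set (blocks K i) = image_mset ((!) xs) (mset_set {skip K (i - 1)..<skip K i})"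
      using image_mset_mset_set[OF inj_on_block[OF K i]] by (simp add: blocks_def)
  qed
  also have "\<dots> = image_mset ((!) xs) (\<Sum>i=1..n. mset_set {skip K (i - 1)..<skip K i})"
    by (induction n) simp_all
  also have "\<dots> = image_mset ((!) xs) (mset_set {..<skip K n})"
    using sum_mset_set_blocks[OF strict_mono_mono[OF strict_mono_skip[OF K'(2)]] K'(3), of n] by simp
  also have "\<dots> = mset (map ((!) xs) [0..<length xs])" using K'(4) by (simp add: atLeast0LessThan)
  also have "\<dots> = m" using xs by (simp only: map_nth)
  finally show "(\<Sum>i=1..n. mset_set (blocks K i)) = m" .
qed

text \<open>The block sizes determine the successive starts, and \<open>K\<close> consists of the
  positions of the word that are not starts.\<close>

lemma inj_on_blocks: "inj_on blocks admissible"
proof (rule inj_onI)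
  fix K L assume K: "K \<in> admissible" and L: "L \<in> admissible" and eq: "blocks K = blocks L"
  have card: "card (blocks J (Suc k)) = skip J (Suc k) - skip J k" if "J \<in> admissible" "k < n" for J k
    using card_image[OF inj_on_block[OF that(1), of "Suc k"]] that(2) by (simp add: blocks_def)
  have skip: "skip K k = skip L k" if "k \<le> n" for k
    using that
  proof (induction k)
    case 0
    then show ?case using admissible(3) K L by simp
  next
    case (Suc k)
    have "skip K k < skip K (Suc k)" "skip L k < skip L (Suc k)"
      using admissible(2)[OF K] admissible(2)[OF L] by simp_all
    moreover have "skip K (Suc k) - skip K k = skip L (Suc k) - skip L k"
      using card[OF K, of k] card[OF L, of k] eq Suc.prems by simp
    ultimately show ?case using Suc by simp
  qed
  have "J = {..<length xs} - skip J ` {..<n}" if J: "J \<in> admissible" for J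
  proof
    show "J \<subseteq> {..<length xs} - skip J ` {..<n}" using admissible[OF J] skip_notin by fastforce
    show "{..<length xs} - skip J ` {..<n} \<subseteq> J"
    proof
      fix p assume p: "p \<in> {..<length xs} - skip J ` {..<n}"
      show "p \<in> J"
      proof (rule ccontr)
        assume "p \<notin> J"
        then obtain k where k: "p = skip J k" using skip_surj admissible(2)[OF J] by metis
        then have "skip J k < skip J n" using admissible(4)[OF J] p by simp
        then have "k < n" using admissible(2)[OF J] by simp
        then show False using p k by simp
      qed
    qed
  qed
  moreover have "skip K ` {..<n} = skip L ` {..<n}" using skip by (intro image_cong) auto
  ultimately show "K = L" using K L by metis
qed

text \<open>Listing each set increasingly and concatenating gives a sorted word with multiset
  \<open>m\<close>, hence \<open>xs\<close>. The required \<open>K\<close> consists of the positions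
  at which no listed set begins.\<close>

lemma blocks_surj:
  assumes \<sigma>: "\<sigma> \<in> set_chains n D" "(\<Sum>i=1..n. mset_set (\<sigma> i)) = m"
  shows "\<sigma> \<in> blocks ` admissible"
proof -
  define f where "f k = sorted_list_of_set (\<sigma> (Suc k))" for k
  \<comment> \<open>\<open>t k\<close> is the 0-based position at which \<open>\<sigma> (k + 1)\<close> starts; blocks of length 1 past the end make \<open>t\<close> strictly increasing on all of \<open>nat\<close>.\<close>
  define t where "t k = (\<Sum>l<k. if l < n then length (f l) else 1)" for k
  define ys where "ys k = concat (map f [0..<k])" for k
  have \<sigma>E: "\<sigma> \<in> {1..n} \<rightarrow>\<^sub>E {S. finite S \<and> S \<noteq> {} \<and> 0 \<notin> S}"
    using \<sigma>(1) unfolding set_chains_def by blast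
  have fs: "finite (\<sigma> (Suc k))" "\<sigma> (Suc k) \<noteq> {}" if "k < n" for k
  proof -
    from \<sigma>E have "\<sigma> (Suc k) \<in> {S. finite S \<and> S \<noteq> {} \<and> 0 \<notin> S}"
      by (rule PiE_mem) (use that in simp)
    then show "finite (\<sigma> (Suc k))" "\<sigma> (Suc k) \<noteq> {}" by simp_all
  qed
  have order: "a \<le> b" "k \<in> D \<Longrightarrow> a < b"
    if "k \<in> {0<..<n}" "a \<in> \<sigma> k" "b \<in> \<sigma> (Suc k)" for k a b
  proof -
    have "\<forall>k\<in>{0<..<n}. \<forall>a\<in>\<sigma> k. \<forall>b\<in>\<sigma> (Suc k). a \<le> b \<and> (k \<in> D \<longrightarrow> a < b)"
      using \<sigma>(1) unfolding set_chains_def mem_Collect_eq by (rule conjunct2)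
    then have "a \<le> b \<and> (k \<in> D \<longrightarrow> a < b)" using that by blast
    then show "a \<le> b" "k \<in> D \<Longrightarrow> a < b" by simp_all
  qed
  have setf: "set (f k) = \<sigma> (Suc k)" if "k < n" for k using fs[OF that] by (simp add: f_def)
  have t: "strict_mono t" unfolding strict_mono_Suc_iff using fs by (auto simp: t_def f_def card_gt_0_iff)
  have t0: "t 0 = 0" by (simp add: t_def)
  have len: "length (ys k) = t k" if "k \<le> n" for k
    using that by (induction k) (simp_all add: ys_def t_def)
  have nth: "ys j ! p = f k ! (p - t k)" if "j \<le> n" "k < j" "t k \<le> p" "p < t (Suc k)" for j k p
    using that
  proof (induction j)
    case (Suc j)
    have ys: "ys (Suc j) = ys j @ f j" by (simp add: ys_def)
    show ?case
    proof (cases "k = j")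
      case True
      then show ?thesis using Suc.prems len[of j] by (simp add: ys nth_append)
    next
      case False
      then have "k < j" using Suc.prems by simp
      then have "p < t j" using Suc.prems t by (metis Suc_leI less_le_trans strict_mono_less_eq)
      then show ?thesis using Suc.IH Suc.prems \<open>k < j\<close> len[of j] by (simp add: ys nth_append)
    qed
  qed simp
  have lenf: "length (f k) = t (Suc k) - t k" if "k < n" for k using that by (simp add: t_def)
  have mem: "ys n ! p \<in> \<sigma> (Suc k)" if "k < n" "t k \<le> p" "p < t (Suc k)" for k p
    using nth[OF _ that] setf[OF that(1)] lenf[OF that(1)] that by (metis diff_less_mono nth_mem order_refl)
  have "mset (ys k) = (\<Sum>i=1..k. mset_set (\<sigma> i))" if "k \<le> n" for k
    using that
  proof (induction k)
    case (Suc k)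
    have "mset (f k) = mset_set (\<sigma> (Suc k))"
      unfolding f_def by (metis mset_sorted_list_of_multiset sorted_list_of_mset_set)
    then show ?case using Suc by (simp add: ys_def)
  qed (simp add: ys_def)
  then have mset: "mset (ys n) = m" using \<sigma>(2) by simp
  \<comment> \<open>A position in the word that is not a start has its predecessor in the same
    listed set, and that list is strictly increasing.\<close>
  have strict: "ys n ! (p - 1) < ys n ! p" if p: "p < t n" "p \<notin> range t" for p
  proof -
    obtain k where k: "k < n" "t k \<le> p" "p < t (Suc k)" using block_of_position[of t, OF t0 p(1)] by blast
    have "t k \<noteq> p" using p(2) by auto
    then have k': "t k \<le> p - 1" "p - 1 < t (Suc k)" "p - 1 - t k < p - t k" using k by auto
    have "sorted_wrt (<) (f k)" by (simp add: f_def)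
    then have "f k ! (p - 1 - t k) < f k ! (p - t k)"
      by (rule sorted_wrt_nth_less) (use k k' lenf[OF k(1)] in auto)
    then show ?thesis using nth[OF order_refl k(1)] k k' by simp
  qed
  \<comment> \<open>Position \<open>t k\<close> opens the list of \<open>\<sigma> (Suc k)\<close>
    and \<open>t k - 1\<close> closes that of \<open>\<sigma> k\<close>; the chain condition
    compares these two letters.\<close>
  have boundary: "ys n ! (t k - 1) \<in> \<sigma> k" "ys n ! t k \<in> \<sigma> (Suc k)" if k: "k \<in> {0<..<n}" for k
  proof -
    obtain l where l: "k = Suc l" using k by (cases k) auto
    have "t l < t k" "t k < t (Suc k)" using t l by (simp_all add: strict_mono_less)
    then show "ys n ! (t k - 1) \<in> \<sigma> k" "ys n ! t k \<in> \<sigma> (Suc k)"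
      using mem[of l "t k - 1"] mem[of k "t k"] that l by auto
  qed
  have inner: "k \<in> {0<..<n}" if "0 < t k" "t k < t n" for k
    using that t t0 by (metis greaterThanLessThan_iff strict_mono_less)
  have "sorted (ys n)"
    unfolding sorted_iff_nth_Suc
  proof (intro allI impI)
    fix p assume "Suc p < length (ys n)"
    then have p: "Suc p < t n" using len by simp
    show "ys n ! p \<le> ys n ! Suc p"
    proof (cases "Suc p \<in> range t")
      case True
      then obtain k where k: "Suc p = t k" by auto
      then have "k \<in> {0<..<n}" using inner[of k] p by simp
      then show ?thesis using order(1)[OF _ boundary] k by (metis diff_Suc_1)
    next
      case False
      then show ?thesis using strict[OF p] by simp
    qed
  qed
  then have ys: "ys n = xs" using mset xs by (metis properties_for_sort sort_key_id_if_sorted)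
  then have tn: "t n = length xs" using len by auto
  \<comment> \<open>Past the word \<open>t\<close> takes every value, so it misses only positions
    inside the word and \<open>K\<close> is finite.\<close>
  have t_plus: "t (n + l) = length xs + l" for l
    using tn by (induction l) (simp_all add: t_def)
  define K where "K = - range t"
  have Ksub: "K \<subseteq> {..<length xs}"
  proof
    fix p assume p: "p \<in> K"
    show "p \<in> {..<length xs}"
    proof (rule ccontr)
      assume "p \<notin> {..<length xs}"
      then have "p = t (n + (p - length xs))" unfolding t_plus by simp
      then show False using p by (auto simp: K_def)
    qed
  qed
  have fin: "finite K" using Ksub finite_subset by blast
  have skip: "skip K = t" using skip_unique[OF t _ fin] by (simp add: K_def)
  have "t (length xs - card K) = t n" using skip_top[OF Ksub] skip tn by simp
  then have "length xs - card K = n" using strict_mono_eq[OF t] by blast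
  moreover have "card K \<le> length xs" using card_mono[OF _ Ksub] by simp
  ultimately have card: "card K = length xs - n" by simp
  have "K \<subseteq> ascents xs"
  proof
    fix p assume p: "p \<in> K"
    then have "p < length xs" "0 < p" using Ksub t0 by (auto simp: K_def intro: gr0I)
    then show "p \<in> ascents xs" using strict[of p] p ys tn by (auto simp: ascents_def K_def)
  qed
  moreover have "D \<subseteq> skip K -` ascents xs"
  proof
    fix k assume k: "k \<in> D"
    then have k': "k \<in> {0<..<n}" using D by auto
    have "t 0 < t k" "t k < t n" using k' t by (simp_all add: strict_mono_less)
    then show "k \<in> skip K -` ascents xs"
      using order(2)[OF k' boundary[OF k'] k] tn ys by (simp add: skip ascents_def)
  qed
  ultimately have "K \<in> admissible" using card by (simp add: admissible_def k_subsets_def)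
  moreover have "blocks K = \<sigma>"
  proof
    fix i
    show "blocks K i = \<sigma> i"
    proof (cases "i \<in> {1..n}")
      case True
      then obtain k where k: "i = Suc k" "k < n" by (cases i) auto
      have "(!) (ys n) ` {t k..<t (Suc k)} = set (f k)"
      proof
        show "(!) (ys n) ` {t k..<t (Suc k)} \<subseteq> set (f k)" using mem[OF k(2)] setf[OF k(2)] by auto
        show "set (f k) \<subseteq> (!) (ys n) ` {t k..<t (Suc k)}"
        proof
          fix x assume "x \<in> set (f k)"
          then obtain r where r: "r < t (Suc k) - t k" "x = f k ! r"
            using lenf[OF k(2)] by (metis in_set_conv_nth)
          then have "x = ys n ! (t k + r)" using nth[OF order_refl k(2), of "t k + r"] by simp
          then show "x \<in> (!) (ys n) ` {t k..<t (Suc k)}" using r by auto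
        qed
      qed
      then show ?thesis using k setf[OF k(2)] True by (simp add: blocks_def skip ys)
    next
      case False
      then show ?thesis using PiE_arb[OF \<sigma>E] by (auto simp: blocks_def)
    qed
  qed
  ultimately show ?thesis by blast
qed

lemma card_set_chains:
  "card {\<sigma> \<in> set_chains n D. (\<Sum>i=1..n. mset_set (\<sigma> i)) = m}
    = card {K \<in> k_subsets (length xs - n) (ascents xs). D \<subseteq> skip K -` ascents xs}"
proof -
  have "bij_betw blocks admissible {\<sigma> \<in> set_chains n D. (\<Sum>i=1..n. mset_set (\<sigma> i)) = m}"
    using inj_on_blocks blocks_set_chains blocks_surj by (auto simp: bij_betw_def)
  then show ?thesis using bij_betw_same_card unfolding admissible_def by fastforce
qed

end

text \<open>For \<open>size m < n\<close> no sequence contributes, whereas truncated subtraction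
  could still let the empty set be counted; hence the separate case. Otherwise the bijection with
  blocks gives the count.\<close>

lemma multi_fundamental_qsym_eq:
  assumes \<alpha>: "\<alpha> \<in> compositions n"
  shows "multi_fundamental_qsym \<alpha> m = (if 0 \<in># m \<or> size m < n then 0
    else int (card {K \<in> k_subsets (size m - n) (jumps m). descent_set \<alpha> \<subseteq> skip K -` jumps m}))"
proof -
  define w where "w = (SOME w. w permutes {1..n} \<and> perm_descents n w = descent_set \<alpha>)"
  have w: "w permutes {1..n} \<and> perm_descents n w = descent_set \<alpha>"
    unfolding w_def using permutation_with_descents[OF descent_set_subset[OF \<alpha>]] by (rule someI_ex)
  let ?S = "{\<sigma> \<in> set_chains n (descent_set \<alpha>). (\<Sum>i=1..n. mset_set (\<sigma> i)) = m}"
  have "sum_list \<alpha> = n" using \<alpha> by (simp add: compositions_def)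
  then have eq: "multi_fundamental_qsym \<alpha> m = int (card ?S)"
    unfolding multi_fundamental_qsym_def monomial_sum_def Let_def
    using w set_sequences_eq_set_chains[of w n] by (simp only: w_def [symmetric])
  show ?thesis
  proof (cases "0 \<in># m \<or> size m < n")
    case True
    have "0 \<notin># m \<and> n \<le> size m" if "\<sigma> \<in> ?S" for \<sigma>
    proof -
      have "\<sigma> \<in> {1..n} \<rightarrow>\<^sub>E {S. finite S \<and> S \<noteq> {} \<and> 0 \<notin> S}"
        using that unfolding set_chains_def by blast
      then have \<sigma>: "finite (\<sigma> i)" "\<sigma> i \<noteq> {}" "0 \<notin> \<sigma> i" if "i \<in> {1..n}" for i
        using PiE_mem[of \<sigma> _ _ i] that by auto
      have m: "m = (\<Sum>i=1..n. mset_set (\<sigma> i))" using that by simp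
      have "count m 0 = 0" unfolding m count_sum using \<sigma> by (intro sum.neutral) auto
      then have "0 \<notin># m" by (simp add: not_in_iff)
      moreover have "size m = (\<Sum>i=1..n. card (\<sigma> i))" by (simp add: m size_multiset_sum)
      moreover have "(\<Sum>i=1..n. 1) \<le> (\<Sum>i=1..n. card (\<sigma> i))"
        using \<sigma> by (intro sum_mono) (simp add: Suc_le_eq card_gt_0_iff)
      ultimately show ?thesis by simp
    qed
    then have "?S = {}" using True by fastforce
    then have "card ?S = 0" by (simp only: card.empty)
    then show ?thesis unfolding eq using True by simp
  next
    case False
    let ?xs = "sorted_list_of_multiset m"
    have len: "length ?xs = size m" by (metis mset_sorted_list_of_multiset size_mset)
    show ?thesis unfolding eq using False
        card_set_chains[of "descent_set \<alpha>" n ?xs m] descent_set_subset[OF \<alpha>]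
      by (simp add: len jumps_def)
  qed
qed

section \<open>The raising maps\<close>

text \<open>The predicate inside the definite description in \<open>fundamental_coeffs\<close>,
  named so that existence and uniqueness can be treated separately.\<close>

definition has_coeffs :: "series \<Rightarrow> (nat list \<Rightarrow> int) \<Rightarrow> bool" where
  "has_coeffs f c \<longleftrightarrow> finite {\<alpha>. c \<alpha> \<noteq> 0} \<and> (\<forall>\<alpha>. c \<alpha> \<noteq> 0 \<longrightarrow> 0 \<notin> set \<alpha>)
     \<and> f = (\<lambda>m. \<Sum>\<alpha> | c \<alpha> \<noteq> 0. c \<alpha> * fundamental_qsym \<alpha> m)"

text \<open>Only compositions of \<open>size m\<close> with descents inside \<open>jumps m\<close>
  contribute, and they correspond to the subsets of \<open>jumps m\<close>. The expansion becomes a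
  subset sum, ready for Moebius inversion.\<close>

lemma sum_fundamental_qsym:
  assumes fin: "finite {\<alpha>. c \<alpha> \<noteq> 0}" and pos: "\<And>\<alpha>. c \<alpha> \<noteq> (0::int) \<Longrightarrow> 0 \<notin> set \<alpha>"
  shows "(\<Sum>\<alpha> | c \<alpha> \<noteq> 0. c \<alpha> * fundamental_qsym \<alpha> m)
    = (if 0 \<in># m then 0 else \<Sum>A\<in>Pow (jumps m). c (composition_of_set (size m) A))"
proof -
  let ?n = "size m"
  let ?C = "{\<alpha> \<in> compositions ?n. descent_set \<alpha> \<subseteq> jumps m}"
  have L: "fundamental_qsym \<alpha> m = of_bool (0 \<notin># m \<and> \<alpha> \<in> ?C)" if "c \<alpha> \<noteq> 0" for \<alpha>
    using pos[OF that] fundamental_qsym_eq[of \<alpha> "sum_list \<alpha>" m] by (auto simp: compositions_def)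
  show ?thesis
  proof (cases "0 \<in># m")
    case True
    then show ?thesis using L by simp
  next
    case False
    have inj: "inj_on (composition_of_set ?n) (Pow (jumps m))"
    proof (rule inj_onI)
      fix A B assume "A \<in> Pow (jumps m)" "B \<in> Pow (jumps m)"
        and eq: "composition_of_set ?n A = composition_of_set ?n B"
      then have "A \<subseteq> {0<..<?n}" "B \<subseteq> {0<..<?n}" using jumps_subset by blast+
      then show "A = B" using composition_of_set(2) eq by metis
    qed
    have img: "composition_of_set ?n ` Pow (jumps m) = ?C"
    proof (intro subset_antisym subsetI)
      fix \<alpha> assume "\<alpha> \<in> composition_of_set ?n ` Pow (jumps m)"
      then obtain A where A: "A \<subseteq> jumps m" "\<alpha> = composition_of_set ?n A" by blast
      then have "A \<subseteq> {0<..<?n}" using jumps_subset by blast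
      then show "\<alpha> \<in> ?C" using composition_of_set A by simp
    next
      fix \<alpha> assume \<alpha>: "\<alpha> \<in> ?C"
      then have "inj_on descent_set (compositions ?n)" "descent_set \<alpha> \<subseteq> {0<..<?n}"
        using bij_betw_imp_inj_on[OF bij_betw_descent_set] descent_set_subset by simp_all
      then have "\<alpha> = composition_of_set ?n (descent_set \<alpha>)"
        using \<alpha> composition_of_set by (metis (lifting) inj_onD mem_Collect_eq)
      then show "\<alpha> \<in> composition_of_set ?n ` Pow (jumps m)" using \<alpha> by blast
    qed
    have "(\<Sum>\<alpha> | c \<alpha> \<noteq> 0. c \<alpha> * fundamental_qsym \<alpha> m) = (\<Sum>\<alpha>\<in>?C. c \<alpha>)"
    proof (rule sum.mono_neutral_cong)
      show "finite ?C" using finite_compositions by simp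
      show "c \<alpha> * fundamental_qsym \<alpha> m = 0" if "\<alpha> \<in> {\<alpha>. c \<alpha> \<noteq> 0} - ?C" for \<alpha>
        using L[of \<alpha>] that by simp
      show "c \<alpha> * fundamental_qsym \<alpha> m = c \<alpha>" if "\<alpha> \<in> {\<alpha>. c \<alpha> \<noteq> 0} \<inter> ?C" for \<alpha>
        using L[of \<alpha>] that False by simp
    qed (use fin in auto)
    also have "\<dots> = (\<Sum>A\<in>Pow (jumps m). c (composition_of_set ?n A))"
      unfolding img[symmetric] by (simp add: sum.reindex[OF inj])
    finally show ?thesis using False by simp
  qed
qed

text \<open>Evaluation at staircase monomials shows that both families have the same subset sums,
  and Moebius inversion recovers the coefficients from these.\<close>

lemma has_coeffs_unique:
  assumes "has_coeffs f c" "has_coeffs f c'"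
  shows "c = c'"
proof
  fix \<alpha>
  show "c \<alpha> = c' \<alpha>"
  proof (cases "0 \<in> set \<alpha>")
    case True
    then show ?thesis using assms unfolding has_coeffs_def by metis
  next
    case False
    define n where "n = sum_list \<alpha>"
    have \<alpha>: "\<alpha> \<in> compositions n" using False by (simp add: compositions_def n_def)
    note D = descent_set_subset[OF \<alpha>]
    have \<alpha>_eq: "composition_of_set n (descent_set \<alpha>) = \<alpha>"
      unfolding composition_of_set_def using bij_betw_imp_inj_on[OF bij_betw_descent_set] \<alpha>
      by (rule the_inv_into_f_f)
    have "f (staircase n A) = (\<Sum>B\<in>Pow A. b (composition_of_set n B))"
      if "has_coeffs f b" "A \<subseteq> {0<..<n}" for b A
      using that sum_fundamental_qsym[of b "staircase n A"]
      by (simp add: has_coeffs_def jumps_staircase del: Pow_iff)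
    then have sums: "(\<Sum>B\<in>Pow A. c (composition_of_set n B)) = (\<Sum>B\<in>Pow A. c' (composition_of_set n B))"
      if "A \<subseteq> {0<..<n}" for A
      using assms that by metis
    \<comment> \<open>The inversion formula asks for subset sums over all finite sets, so the
      coefficients in degree \<open>n\<close> are extended by 0 to sets outside the allowed
      positions.\<close>
    define h where "h b B = (if B \<subseteq> {0<..<n} then b (composition_of_set n B) else 0)"
      for b :: "nat list \<Rightarrow> int" and B
    have h: "sum (h b) (Pow S) = (\<Sum>B\<in>Pow (S \<inter> {0<..<n}). b (composition_of_set n B))"
      if "finite S" for S b
      using that by (intro sum.mono_neutral_cong) (auto simp: h_def)
    have "sum (h c) (Pow S) = sum (h c') (Pow S)" if "finite S" for S
      unfolding h[OF that] by (rule sums) blast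
    then have "h c (descent_set \<alpha>) = h c' (descent_set \<alpha>)"
      using inclusion_exclusion_mobius[of "\<lambda>S. sum (h c) (Pow S)" "h c" "descent_set \<alpha>"]
        inclusion_exclusion_mobius[of "\<lambda>S. sum (h c) (Pow S)" "h c'" "descent_set \<alpha>"]
        finite_subset[OF D] by simp
    then show ?thesis using D \<alpha>_eq by (simp add: h_def)
  qed
qed

text \<open>Moebius inversion of the values of \<open>f\<close> at staircase monomials supplies the
  coefficients; quasisymmetry carries the expansion over to all monomials, and bounded degree makes
  the support finite.\<close>

lemma has_coeffs_exists:
  assumes f: "f \<in> QSym"
  shows "\<exists>c. has_coeffs f c"
proof -
  obtain d where d: "\<And>m. d < size m \<Longrightarrow> f m = 0" and f0: "\<And>m. 0 \<in># m \<Longrightarrow> f m = 0"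
    using f unfolding QSym_def by blast
  \<comment> \<open>The two signs combine to the parity of \<open>A - B\<close>, the Moebius
    function of the subset lattice.\<close>
  define h where "h n A = (-1) ^ card A * (\<Sum>B\<in>Pow A. (-1) ^ card B * f (staircase n B))" for n and A :: "nat set"
  have sum_h: "(\<Sum>A\<in>Pow S. h n A) = f (staircase n S)" if "finite S" for n S
    unfolding h_def
    using inclusion_exclusion_symmetric[of "\<lambda>S. \<Sum>T\<in>Pow S. (-1) ^ card T * f (staircase n T)"
        "\<lambda>T. f (staircase n T)" S] that
    by simp
  define c where "c \<alpha> = (if 0 \<in> set \<alpha> then 0 else h (sum_list \<alpha>) (descent_set \<alpha>))" for \<alpha>
  have pos: "0 \<notin> set \<alpha>" if "c \<alpha> \<noteq> 0" for \<alpha> using that by (auto simp: c_def)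
  have "\<alpha> \<in> (\<Union>n\<le>d. compositions n)" if \<alpha>: "c \<alpha> \<noteq> 0" for \<alpha>
  proof -
    have "sum_list \<alpha> \<le> d"
    proof (rule ccontr)
      assume "\<not> sum_list \<alpha> \<le> d"
      then have "h (sum_list \<alpha>) (descent_set \<alpha>) = 0" unfolding h_def using d by simp
      then show False using \<alpha> by (simp add: c_def split: if_splits)
    qed
    then show ?thesis using pos[OF \<alpha>] by (simp add: compositions_def)
  qed
  then have "{\<alpha>. c \<alpha> \<noteq> 0} \<subseteq> (\<Union>n\<le>d. compositions n)" by blast
  then have fin: "finite {\<alpha>. c \<alpha> \<noteq> 0}" by (rule finite_subset) (simp add: finite_compositions)
  have c: "c (composition_of_set n A) = h n A" if "A \<subseteq> {0<..<n}" for n A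
    using composition_of_set[OF that] by (simp add: c_def compositions_def)
  have "f m = (\<Sum>\<alpha> | c \<alpha> \<noteq> 0. c \<alpha> * fundamental_qsym \<alpha> m)" for m
  proof (cases "0 \<in># m")
    case True
    then show ?thesis using f0 sum_fundamental_qsym[OF fin pos] by simp
  next
    case False
    have "f m = (\<Sum>A\<in>Pow (jumps m). h (size m) A)"
      using sum_h[OF finite_jumps] QSym_staircase[OF f False] by simp
    also have "\<dots> = (\<Sum>A\<in>Pow (jumps m). c (composition_of_set (size m) A))"
    proof (intro sum.cong refl)
      fix A assume "A \<in> Pow (jumps m)"
      then have "A \<subseteq> {0<..<size m}" using jumps_subset by blast
      then show "h (size m) A = c (composition_of_set (size m) A)" using c by simp
    qed
    finally show ?thesis using sum_fundamental_qsym[OF fin pos] False by simp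
  qed
  then show ?thesis using fin pos unfolding has_coeffs_def by blast
qed

lemma has_coeffs_fundamental_coeffs:
  assumes "f \<in> QSym"
  shows "has_coeffs f (fundamental_coeffs f)"
proof -
  have "\<exists>!c. has_coeffs f c" using has_coeffs_exists[OF assms] has_coeffs_unique by blast
  then have "has_coeffs f (THE c. has_coeffs f c)" by (rule theI')
  moreover have "fundamental_coeffs f = (THE c. has_coeffs f c)"
    unfolding fundamental_coeffs_def has_coeffs_def ..
  ultimately show ?thesis by (simp only:)
qed

section \<open>The coefficient formula for the raising maps\<close>

text \<open>Keeps the subtraction \<open>size m - i\<close> from truncating whenever some
  \<open>K\<close> occurs in the sums below.\<close>

lemma card_le_size:
  assumes "K \<in> k_subsets i (jumps m)"
  shows "i \<le> size m"
proof -
  have "K \<subseteq> {0<..<size m}" "card K = i" using assms jumps_subset unfolding k_subsets_def by blast+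
  then show ?thesis using card_mono[of "{0<..<size m}" K] by simp
qed

lemma jumps_staircase_skip:
  assumes "K \<in> k_subsets i (jumps m)"
  shows "jumps (staircase (size m - i) (skip K -` jumps m)) = skip K -` jumps m"
  using skip_vimage_subset[OF jumps_subset, of K m] assms
  by (intro jumps_staircase) (simp add: k_subsets_def)

text \<open>The count of sets \<open>K\<close> is rewritten as a sum of coefficients of
  \<open>fundamental_qsym \<alpha>\<close> at monomials of degree \<open>size m - i\<close>. In this
  form the right-hand side is linear in the function being raised.\<close>

lemma homogeneous_part_multi_fundamental_qsym:
  assumes "0 \<notin> set \<alpha>"
  shows "homogeneous_part (i + sum_list \<alpha>) (multi_fundamental_qsym \<alpha>) m
    = (if 0 \<in># m then 0 else \<Sum>K\<in>k_subsets i (jumps m).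
        fundamental_qsym \<alpha> (staircase (size m - i) (skip K -` jumps m)))"
proof (cases "0 \<in># m")
  case True
  have "\<alpha> \<in> compositions (sum_list \<alpha>)" using assms by (simp add: compositions_def)
  from multi_fundamental_qsym_eq[OF this, of m] True show ?thesis by (simp add: homogeneous_part_def)
next
  case False
  let ?J = "jumps m"
  have \<alpha>: "\<alpha> \<in> compositions (sum_list \<alpha>)" using assms by (simp add: compositions_def)
  have "fundamental_qsym \<alpha> (staircase (size m - i) (skip K -` ?J))
      = of_bool (size m = i + sum_list \<alpha> \<and> descent_set \<alpha> \<subseteq> skip K -` ?J)"
    if "K \<in> k_subsets i ?J" for K
    using card_le_size[OF that] by (auto simp: fundamental_qsym_eq[OF \<alpha>] jumps_staircase_skip[OF that])
  then have "(\<Sum>K\<in>k_subsets i ?J. fundamental_qsym \<alpha> (staircase (size m - i) (skip K -` ?J)))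
    = (\<Sum>K\<in>k_subsets i ?J. of_bool (size m = i + sum_list \<alpha> \<and> descent_set \<alpha> \<subseteq> skip K -` ?J))"
    by simp
  also have "\<dots> = homogeneous_part (i + sum_list \<alpha>) (multi_fundamental_qsym \<alpha>) m"
    using finite_k_subsets[OF finite_jumps] False
    by (simp add: homogeneous_part_def multi_fundamental_qsym_eq[OF \<alpha>] Int_def)
  finally show ?thesis using False by simp
qed

text \<open>The right-hand side is linear in \<open>f\<close> and correct on the fundamental basis,
  so it suffices to expand \<open>f\<close> and exchange the two sums. Coordinates no longer appear
  afterwards.\<close>

lemma qsym_raise_eq:
  assumes "f \<in> QSym"
  shows "qsym_raise i f m = (if 0 \<in># m then 0 else
    \<Sum>K\<in>k_subsets i (jumps m). f (staircase (size m - i) (skip K -` jumps m)))"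
proof -
  define c where "c = fundamental_coeffs f"
  have c: "\<And>\<alpha>. c \<alpha> \<noteq> 0 \<Longrightarrow> 0 \<notin> set \<alpha>" "\<And>m. f m = (\<Sum>\<alpha> | c \<alpha> \<noteq> 0. c \<alpha> * fundamental_qsym \<alpha> m)"
    using has_coeffs_fundamental_coeffs[OF assms] unfolding c_def has_coeffs_def by metis+
  have "qsym_raise i f m = (\<Sum>\<alpha> | c \<alpha> \<noteq> 0. c \<alpha> * (if 0 \<in># m then 0 else
      \<Sum>K\<in>k_subsets i (jumps m). fundamental_qsym \<alpha> (staircase (size m - i) (skip K -` jumps m))))"
    unfolding qsym_raise_def c_def[symmetric]
    by (intro sum.cong refl) (simp add: homogeneous_part_multi_fundamental_qsym c(1))
  also have "\<dots> = (if 0 \<in># m then 0 else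
      \<Sum>K\<in>k_subsets i (jumps m). f (staircase (size m - i) (skip K -` jumps m)))"
  proof (cases "0 \<in># m")
    case False
    then show ?thesis unfolding c(2) by (simp add: sum_distrib_left) (rule sum.swap)
  qed simp
  finally show ?thesis .
qed

text \<open>By the coefficient formula the value depends only on degree and ascents, and it vanishes
  in degrees above \<open>d + i\<close>.\<close>

lemma qsym_raise_QSym:
  assumes f: "f \<in> QSym"
  shows "qsym_raise i f \<in> QSym"
proof -
  obtain d where d: "\<And>m. d < size m \<Longrightarrow> f m = 0" using f unfolding QSym_def by blast
  show ?thesis
    by (rule QSymI[where d = "d + i"]) (auto simp: qsym_raise_eq[OF f] d intro!: sum.neutral)
qed

text \<open>The outer map acts on \<open>m\<close> first, so \<open>K\<close> of size
  \<open>j\<close> is removed before \<open>K'\<close> of size \<open>i\<close>;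
  \<open>sum_skip_skip\<close> merges the two removals.\<close>

lemma qsym_raise_qsym_raise:
  assumes f: "f \<in> QSym"
  shows "qsym_raise j (qsym_raise i f) m = int ((i + j) choose i) * qsym_raise (i + j) f m"
proof (cases "0 \<in># m")
  case True
  then show ?thesis by (simp add: qsym_raise_eq f qsym_raise_QSym)
next
  case False
  let ?J = "jumps m" and ?n = "size m - (i + j)"
  have "qsym_raise j (qsym_raise i f) m
    = (\<Sum>K\<in>k_subsets j ?J. qsym_raise i f (staircase (size m - j) (skip K -` ?J)))"
    using False by (simp add: qsym_raise_eq[OF qsym_raise_QSym[OF f]])
  also have "\<dots> = (\<Sum>K\<in>k_subsets j ?J. \<Sum>K'\<in>k_subsets i (skip K -` ?J). f (staircase ?n (skip K' -` (skip K -` ?J))))"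
    by (intro sum.cong refl) (simp add: qsym_raise_eq[OF f] jumps_staircase_skip add.commute)
  also have "\<dots> = int ((i + j) choose i) * (\<Sum>U\<in>k_subsets (i + j) ?J. f (staircase ?n (skip U -` ?J)))"
    by (rule sum_skip_skip[OF finite_jumps])
  also have "\<dots> = int ((i + j) choose i) * qsym_raise (i + j) f m"
    using False by (simp add: qsym_raise_eq[OF f])
  finally show ?thesis .
qed

lemma skip_image:
  assumes K: "K \<in> k_subsets i {0<..<n + i}"
  shows "skip K ` {0<..<n} = {0<..<n + i} - K" "skip K n = n + i" "finite K" "skip K 0 = 0"
proof -
  have sub: "K \<subseteq> {0<..<n + i}" and card: "card K = i" using K by (auto simp: k_subsets_def)
  show fin: "finite K" using sub by (rule finite_subset) simp
  show 0: "skip K 0 = 0" using sub fin by (intro skip_0) auto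
  have "K \<subseteq> {..<n + i}" using sub by auto
  from skip_top[OF this] show n: "skip K n = n + i" by (simp add: card)
  have mem: "0 < skip K k \<and> skip K k < n + i \<longleftrightarrow> 0 < k \<and> k < n" for k
    using skip_less_iff[OF fin, of 0 k] skip_less_iff[OF fin, of k n] unfolding 0 n by simp
  show "skip K ` {0<..<n} = {0<..<n + i} - K"
  proof (intro subset_antisym subsetI)
    fix x assume "x \<in> skip K ` {0<..<n}"
    then obtain k where "x = skip K k" "0 < k \<and> k < n" by auto
    then show "x \<in> {0<..<n + i} - K" using mem[of k] skip_notin[OF fin] by simp
  next
    fix x assume x: "x \<in> {0<..<n + i} - K"
    then obtain k where "x = skip K k" using skip_surj[OF fin] by blast
    then show "x \<in> skip K ` {0<..<n}" using x mem by auto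
  qed
qed

section \<open>Extensions\<close>

text \<open>An extension \<open>t\<close> is the restriction of \<open>skip K\<close>, where
  \<open>K\<close> is the set of interior positions missed by \<open>t\<close>. Its two conditions
  on \<open>E\<close> say together that \<open>E\<close> is the disjoint union of the image of
  \<open>D\<close> and \<open>K\<close>.\<close>

lemma card_extensions:
  assumes n: "1 \<le> n" and D: "D \<subseteq> {0<..<n}"
  shows "card (extensions n i D E) = card {K \<in> k_subsets i {0<..<n + i}. skip K ` D \<union> K = E}"
proof -
  have I: "{1..n - 1} = {0<..<n}" "{1..n + i - 1} = {0<..<n + i}" using n by auto
  let ?\<S> = "{K \<in> k_subsets i {0<..<n + i}. skip K ` D \<union> K = E}"
  let ?\<phi> = "\<lambda>K. restrict (skip K) {0<..<n}"
  have "bij_betw ?\<phi> ?\<S> (extensions n i D E)"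
    unfolding bij_betw_def
  proof (intro conjI subset_antisym subsetI)
    show "inj_on ?\<phi> ?\<S>"
    proof (rule inj_onI)
      fix K L assume K: "K \<in> ?\<S>" and L: "L \<in> ?\<S>" and eq: "?\<phi> K = ?\<phi> L"
      have "{0<..<n + i} - K = {0<..<n + i} - L"
        using skip_image(1)[of K] skip_image(1)[of L] K L eq image_restrict_eq
        by (metis (no_types, lifting) mem_Collect_eq)
      moreover have "K \<subseteq> {0<..<n + i}" "L \<subseteq> {0<..<n + i}" using K L by (simp_all add: k_subsets_def)
      ultimately show "K = L" by blast
    qed
  next
    fix t assume "t \<in> ?\<phi> ` ?\<S>"
    then obtain K where K: "K \<in> k_subsets i {0<..<n + i}" "skip K ` D \<union> K = E" and t: "t = ?\<phi> K" by blast
    note K' = skip_image[OF K(1)]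
    have sub: "K \<subseteq> {0<..<n + i}" using K by (simp add: k_subsets_def)
    have tD: "t ` D = skip K ` D" and tI: "t ` {0<..<n} = {0<..<n + i} - K"
      using D K'(1) by (auto simp: t)
    have "E - t ` D = K" using K(2) skip_notin[OF K'(3)] unfolding tD by blast
    also have "\<dots> = {0<..<n + i} - t ` {0<..<n}" using sub unfolding tI by blast
    finally have "E - t ` D = {0<..<n + i} - t ` {0<..<n}" .
    moreover have "t \<in> {0<..<n} \<rightarrow>\<^sub>E {0<..<n + i}" using tI unfolding t by (auto simp: PiE_iff)
    moreover have "inj_on t {0<..<n}" "mono_on {0<..<n} t"
      using K'(3) by (auto simp: t inj_on_def mono_on_def)
    ultimately show "t \<in> extensions n i D E"
      using K(2) tD unfolding extensions_def I by blast
  next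
    fix t assume "t \<in> extensions n i D E"
    then have t: "t \<in> {0<..<n} \<rightarrow>\<^sub>E {0<..<n + i}" "inj_on t {0<..<n}" "mono_on {0<..<n} t"
      "t ` D \<subseteq> E" "E - t ` D = {0<..<n + i} - t ` {0<..<n}"
      unfolding extensions_def I by blast+
    define K where "K = {0<..<n + i} - t ` {0<..<n}"
    have img: "t ` {0<..<n} \<subseteq> {0<..<n + i}" using t(1) by auto
    have "card K = i"
      using n card_image[OF t(2)] img by (simp add: K_def card_Diff_subset)
    then have K: "K \<in> k_subsets i {0<..<n + i}" by (auto simp: k_subsets_def K_def)
    \<comment> \<open>\<open>u\<close> prolongs \<open>t\<close> by fixing 0 and shifting by
      \<open>i\<close> from \<open>n\<close> on. It is strictly increasing with range the complement
      of \<open>K\<close>, hence equal to \<open>skip K\<close>.\<close>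
    define u where "u k = (if k = 0 then 0 else if k < n then t k else k + i)" for k
    have less: "t k < t l" if "k \<in> {0<..<n}" "l \<in> {0<..<n}" "k < l" for k l
      using that t(2,3) by (metis inj_onD le_neq_implies_less less_imp_le mono_onD nat_neq_iff)
    have bd: "0 < t k" "t k < n + i" if "k \<in> {0<..<n}" for k
    proof -
      have "t k \<in> {0<..<n + i}" using img that by blast
      then show "0 < t k" "t k < n + i" by simp_all
    qed
    have "strict_mono u"
    proof (rule strict_monoI)
      fix k l :: nat assume "k < l"
      then show "u k < u l" using less[of k l] bd[of k] bd[of l] by (auto simp: u_def)
    qed
    moreover have "range u = - K"
    proof (intro subset_antisym subsetI)
      fix x assume "x \<in> range u"
      then show "x \<in> - K" by (auto simp: u_def K_def)
    next
      fix x assume "x \<in> - K"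
      then consider "x = 0" | "x \<ge> n + i" | k where "k \<in> {0<..<n}" "x = t k"
        by (auto simp: K_def)
      then show "x \<in> range u"
      proof cases
        case 1
        then have "x = u 0" by (simp add: u_def)
        then show ?thesis by blast
      next
        case 2
        then have "\<not> x - i < n" "x - i \<noteq> 0" using n by linarith+
        then have "x = u (x - i)" using 2 by (simp add: u_def)
        then show ?thesis by blast
      next
        case (3 k)
        then have "x = u k" by (simp add: u_def)
        then show ?thesis by blast
      qed
    qed
    ultimately have skip: "u = skip K" using skip_image(3)[OF K] by (rule skip_unique)
    have "?\<phi> K = t"
    proof (rule extensionalityI)
      show "?\<phi> K \<in> extensional {0<..<n}" "t \<in> extensional {0<..<n}" using t(1) by (auto simp: PiE_iff)
    qed (simp add: u_def flip: skip)
    moreover have "skip K ` D = t ` D"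
    proof (rule image_cong)
      fix k assume "k \<in> D"
      then have "k \<in> {0<..<n}" using D by blast
      then show "skip K k = t k" by (simp add: u_def flip: skip)
    qed simp
    moreover have "t ` D \<union> K = E" using t(4) unfolding K_def t(5)[symmetric] by blast
    ultimately have "K \<in> ?\<S>" "t = ?\<phi> K" using K by simp_all
    then show "t \<in> ?\<phi> ` ?\<S>" by (rule rev_image_eqI)
  qed
  then show ?thesis by (rule bij_betw_same_card[symmetric])
qed

text \<open>Each \<open>K\<close> determines one \<open>E\<close>, so grouping the sets
  \<open>K\<close> by that \<open>E\<close> turns the cardinalities into a plain sum over
  \<open>K\<close>.\<close>

lemma sum_extensions:
  fixes F :: "nat set \<Rightarrow> int"
  assumes n: "1 \<le> n" and D: "D \<subseteq> {0<..<n}"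
  shows "(\<Sum>E\<in>Pow {1..n + i - 1}. int (card (extensions n i D E)) * F E)
    = (\<Sum>K\<in>k_subsets i {0<..<n + i}. F (skip K ` D \<union> K))"
proof -
  have I: "{1..n + i - 1} = {0<..<n + i}" using n by auto
  have "(\<Sum>E\<in>Pow {0<..<n + i}. int (card (extensions n i D E)) * F E)
    = (\<Sum>E\<in>Pow {0<..<n + i}. \<Sum>K | K \<in> k_subsets i {0<..<n + i} \<and> skip K ` D \<union> K = E. F (skip K ` D \<union> K))"
    by (simp add: card_extensions[OF n D])
  also have "\<dots> = (\<Sum>K\<in>k_subsets i {0<..<n + i}. F (skip K ` D \<union> K))"
  proof (rule sum.group)
    show "(\<lambda>K. skip K ` D \<union> K) ` k_subsets i {0<..<n + i} \<subseteq> Pow {0<..<n + i}"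
    proof (intro image_subsetI PowI)
      fix K assume K: "K \<in> k_subsets i {0<..<n + i}"
      then have "K \<subseteq> {0<..<n + i}" by (simp add: k_subsets_def)
      moreover have "skip K ` D \<subseteq> {0<..<n + i}" using skip_image(1)[OF K] D by blast
      ultimately show "skip K ` D \<union> K \<subseteq> {0<..<n + i}" by blast
    qed
  qed (simp_all add: finite_k_subsets)
  finally show ?thesis unfolding I .
qed

section \<open>Expansions in both bases\<close>

text \<open>Handles both bases at once: \<open>P\<close> is inclusion for the fundamental functions
  and equality for the monomial ones. \<open>P_skip\<close> trades the relation between
  \<open>E\<close> and \<open>jumps m\<close> for one between the descent set and the preimage of
  \<open>jumps m\<close>, the form found in \<open>qsym_raise_eq\<close>.\<close>

lemma qsym_raise_expansion:
  assumes n: "1 \<le> n" and \<alpha>: "\<alpha> \<in> compositions n" and f: "f \<in> QSym"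
    and P: "\<And>m. f m = of_bool (0 \<notin># m \<and> size m = n \<and> P (descent_set \<alpha>) (jumps m))"
    and F: "\<And>E m. E \<subseteq> {0<..<n + i} \<Longrightarrow> F (composition_of_set (n + i) E) m = of_bool (0 \<notin># m \<and> size m = n + i \<and> P E (jumps m))"
    and P_skip: "\<And>D K J. finite K \<Longrightarrow> P (skip K ` D \<union> K) J \<longleftrightarrow> K \<subseteq> J \<and> P D (skip K -` J)"
  shows "qsym_raise i f m = (\<Sum>E\<in>Pow {1..n + i - 1}. int (card (extensions n i (descent_set \<alpha>) E)) *
           F (composition_of_set (n + i) E) m)"
proof -
  let ?D = "descent_set \<alpha>" and ?J = "jumps m"
  note D = descent_set_subset[OF \<alpha>]
  have I: "{1..n + i - 1} = {0<..<n + i}" using n by auto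
  have "(\<Sum>E\<in>Pow {1..n + i - 1}. int (card (extensions n i ?D E)) * F (composition_of_set (n + i) E) m)
    = (\<Sum>E\<in>Pow {1..n + i - 1}. int (card (extensions n i ?D E)) * of_bool (0 \<notin># m \<and> size m = n + i \<and> P E ?J))"
    unfolding I by (intro sum.cong refl) (simp add: F)
  also have "\<dots> = (\<Sum>K\<in>k_subsets i {0<..<n + i}. of_bool (0 \<notin># m \<and> size m = n + i \<and> P (skip K ` ?D \<union> K) ?J))"
    by (rule sum_extensions[OF n D])
  also have "\<dots> = (\<Sum>K\<in>k_subsets i {0<..<n + i}. of_bool (0 \<notin># m \<and> size m = n + i \<and> K \<subseteq> ?J \<and> P ?D (skip K -` ?J)))"
    by (intro sum.cong refl) (simp add: P_skip skip_image(3))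
  also have "\<dots> = (if 0 \<in># m then 0 else
    \<Sum>K\<in>k_subsets i ?J. of_bool (size m = n + i \<and> P ?D (skip K -` ?J)))"
  \<comment> \<open>In degree \<open>n + i\<close> all ascents are interior positions, so the sets
    \<open>K\<close> contained in \<open>jumps m\<close> are precisely its \<open>i\<close>-subsets.
    In the other case both sides vanish.\<close>
  proof (cases "0 \<notin># m \<and> size m = n + i")
    case True
    then have J: "?J \<subseteq> {0<..<n + i}" using jumps_subset by metis
    have "(\<Sum>K\<in>k_subsets i {0<..<n + i}. of_bool (0 \<notin># m \<and> size m = n + i \<and> K \<subseteq> ?J \<and> P ?D (skip K -` ?J)))
      = (\<Sum>K\<in>k_subsets i ?J. of_bool (size m = n + i \<and> P ?D (skip K -` ?J)))"
      by (rule sum.mono_neutral_cong)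
        (use True J in \<open>auto simp: k_subsets_def[of i] intro!: finite_k_subsets finite_jumps\<close>)
    then show ?thesis using True by simp
  qed auto
  also have "\<dots> = (if 0 \<in># m then 0 else \<Sum>K\<in>k_subsets i ?J. f (staircase (size m - i) (skip K -` ?J)))"
  proof (intro if_cong sum.cong refl)
    fix K assume K: "K \<in> k_subsets i ?J"
    show "of_bool (size m = n + i \<and> P ?D (skip K -` ?J)) = f (staircase (size m - i) (skip K -` ?J))"
      using card_le_size[OF K] by (auto simp: P jumps_staircase_skip[OF K])
  qed
  also have "\<dots> = qsym_raise i f m" by (simp add: qsym_raise_eq[OF f])
  finally show ?thesis by simp
qed

theorem theorem5p12:
  shows "(\<forall>n \<alpha> i. 1 \<le> n \<and> \<alpha> \<in> compositions n \<longrightarrow>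
      qsym_raise i (fundamental_qsym \<alpha>) =
        (\<lambda>m. \<Sum>E\<in>Pow {1..n + i - 1}. int (card (extensions n i (descent_set \<alpha>) E)) *
           fundamental_qsym (composition_of_set (n + i) E) m) \<and>
      qsym_raise i (monomial_qsym \<alpha>) =
        (\<lambda>m. \<Sum>E\<in>Pow {1..n + i - 1}. int (card (extensions n i (descent_set \<alpha>) E)) *
           monomial_qsym (composition_of_set (n + i) E) m)) \<and>
    (\<forall>i j. \<forall>f\<in>QSym. qsym_raise j (qsym_raise i f) =
        (\<lambda>m. int ((i + j) choose i) * qsym_raise (i + j) f m))"
proof (intro conjI allI impI ballI ext)
  fix n \<alpha> i m
  assume "1 \<le> n \<and> \<alpha> \<in> compositions n"
  then have n: "1 \<le> n" and \<alpha>: "\<alpha> \<in> compositions n" by auto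
  have pos: "0 \<notin> set \<alpha>" using \<alpha> by (simp add: compositions_def)
  show "qsym_raise i (fundamental_qsym \<alpha>) m =
      (\<Sum>E\<in>Pow {1..n + i - 1}. int (card (extensions n i (descent_set \<alpha>) E)) *
         fundamental_qsym (composition_of_set (n + i) E) m)"
    by (rule qsym_raise_expansion[OF n \<alpha> fundamental_qsym_QSym[OF pos], where P = "(\<subseteq>)"])
      (auto simp: fundamental_qsym_eq[OF \<alpha>] fundamental_qsym_eq[OF composition_of_set(1)] composition_of_set(2))
  \<comment> \<open>\<open>K\<close> and the range of \<open>skip K\<close> are complementary and
    \<open>skip K\<close> is injective, so \<open>D\<close> is recovered from the union as a
    preimage, and the image of that preimage is \<open>J - K\<close>.\<close>
  have skip_eq: "skip K ` D \<union> K = J \<longleftrightarrow> K \<subseteq> J \<and> D = skip K -` J" if "finite K" for D K J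
  proof
    assume J: "skip K ` D \<union> K = J"
    have "x \<in> D \<longleftrightarrow> skip K x \<in> J" for x
      unfolding J[symmetric] using skip_notin[OF that] by (simp add: inj_image_mem_iff inj_on_skip that)
    then show "K \<subseteq> J \<and> D = skip K -` J" using J by blast
  next
    assume J: "K \<subseteq> J \<and> D = skip K -` J"
    then have "skip K ` D = J - K" using range_skip[OF that] by (auto simp: image_vimage_eq)
    then show "skip K ` D \<union> K = J" using J by blast
  qed
  \<comment> \<open>\<open>monomial_qsym_eq\<close> has \<open>jumps m\<close> on the left of the
    equation, whereas \<open>P\<close> takes it as second argument; this rule turns the equation
    around.\<close>
  have jumps_eq: "jumps m = A \<longleftrightarrow> A = jumps m" for m A by auto
  show "qsym_raise i (monomial_qsym \<alpha>) m =
      (\<Sum>E\<in>Pow {1..n + i - 1}. int (card (extensions n i (descent_set \<alpha>) E)) *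
         monomial_qsym (composition_of_set (n + i) E) m)"
    by (rule qsym_raise_expansion[OF n \<alpha> monomial_qsym_QSym[OF pos], where P = "(=)"])
      (simp_all add: monomial_qsym_eq[OF \<alpha>] monomial_qsym_eq[OF composition_of_set(1)]
        composition_of_set(2) skip_eq jumps_eq)
next
  fix i j f m
  assume "f \<in> QSym"
  then show "qsym_raise j (qsym_raise i f) m = int ((i + j) choose i) * qsym_raise (i + j) f m"
    by (rule qsym_raise_qsym_raise)
qed

end
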